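(* (1) The Borel sigma-field $\mathscr B(\mathbb J)$ of $(\mathbb J,\mathfrak T_\sharp(\mathbb J))$ equals the sigma-field generated by the mappings $I_\varphi:\mathbb J\to[-\infty,\infty]$, $\varphi\in L^0((0,\infty)\times\mathbb U;\mathbb R)$. (2) Let $\psi:(0,\infty)\times\Omega_X\times\mathbb R^{d+l}\times\mathbb U\to[-\infty,\infty]$ be a Borel-measurable function. Then the mapping $$\Psi(t,\mathfrak s,\omega_0,\omega_X,\mathfrak u):=\int_t^{t+\mathfrak s}\psi\big(r,\omega_X(r\wedge\cdot),\omega_0(r),\omega_X(r),\mathfrak u(r)\big)dr,$$ defined as $\int_t^{t+\mathfrak s}\psi^+\big(r,\omega_X(r\wedge\cdot),\omega_0(r),\omega_X(r),\mathfrak u(r)\big)dr-\int_t^{t+\mathfrak s}\psi^-\big(r,\omega_X(r\wedge\cdot),\omega_0(r),\omega_X(r),\mathfrak u(r)\big)dr$ for $(t,\mathfrak s,\omega_0,\omega_X,\mathfrak u)\in[0,\infty)\times[0,\infty)\times\Omega_0\times\Omega_X\times\mathbb J$, is $\mathscr B[0,\infty)\otimes\mathscr B[0,\infty)\otimes\mathscr B(\Omega_0)\otimes\mathscr B(\Omega_X)\otimes\mathscr B(\mathbb J)$-measurable.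
   Context: Fix $d,l\in\mathbb N$. $\Omega_0=\{\omega\in C([0,\infty);\mathbb R^d):\omega(0)=0\}$ and $\Omega_X=C([0,\infty);\mathbb R^l)$ carry the topology of locally uniform convergence. $\mathbb U$ is a Polish space. $\mathbb J=L^0([0,\infty);\mathbb U)$ is the set of a.e.-equivalence classes of $\mathbb U$-valued Borel measurable functions on $[0,\infty)$, with the topology $\mathfrak T_\sharp(\mathbb J)$ induced by the topology of weak convergence on the Borel probability measures $\mathfrak P([0,\infty)\times\mathbb U)$ via $\mathfrak u\mapsto e^{-t}\delta_{\mathfrak u(t)}(du)\,dt$. $L^0((0,\infty)\times\mathbb U;\mathbb R)$ is the set of all real-valued Borel-measurable functions on $(0,\infty)\times\mathbb U$. For $\varphi$ in it, $I_\varphi(\mathfrak u):=\int_0^\infty\varphi(s,\mathfrak u(s))ds:=\int_0^\infty\varphi^+(s,\mathfrak u(s))ds-\int_0^\infty\varphi^-(s,\mathfrak u(s))ds$, $\mathfrak u\in\mathbb J$. Convention: $(+\infty)+(-\infty)=-\infty$. *)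

theory Defs
  imports "HOL-Probability.Probability"
begin

section \<open>Integrals with values in the extended reals\<close>

text \<open>
  Addition on \<^typ>\<open>ereal\<close> satisfies \<open>\<infinity> + (-\<infinity>) = \<infinity>\<close>.  Here the convention is
  \<open>(+\<infinity>) + (-\<infinity>) = (-\<infinity>) + (+\<infinity>) = -\<infinity>\<close> instead.
\<close>

definition conv_add :: "ereal \<Rightarrow> ereal \<Rightarrow> ereal" where
  "conv_add x y =
     (if x = \<infinity> \<and> y = -\<infinity> \<or> x = -\<infinity> \<and> y = \<infinity> then -\<infinity> else x + y)"

definition ext_integral :: "'a measure \<Rightarrow> ('a \<Rightarrow> ereal) \<Rightarrow> ereal" where
  "ext_integral M f =
     conv_add (enn2ereal (\<integral>\<^sup>+ x. e2ennreal (max 0 (f x)) \<partial>M))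
              (- enn2ereal (\<integral>\<^sup>+ x. e2ennreal (max 0 (- f x)) \<partial>M))"

lemma ext_integral_cong_AE:
  assumes "AE x in M. f x = g x"
  shows "ext_integral M f = ext_integral M g"
proof -
  have "(\<integral>\<^sup>+ x. e2ennreal (max 0 (f x)) \<partial>M) = (\<integral>\<^sup>+ x. e2ennreal (max 0 (g x)) \<partial>M)"
    by (rule nn_integral_cong_AE) (use assms in eventually_elim, simp)
  moreover have "(\<integral>\<^sup>+ x. e2ennreal (max 0 (- f x)) \<partial>M) = (\<integral>\<^sup>+ x. e2ennreal (max 0 (- g x)) \<partial>M)"
    by (rule nn_integral_cong_AE) (use assms in eventually_elim, simp)
  ultimately show ?thesis by (simp add: ext_integral_def)
qed


section \<open>The path spaces\<close>

text \<open>\<open>C([0,\<infinity>); 'a)\<close>; extensionality makes a path determined by its values on \<open>[0,\<infinity>)\<close>.\<close>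

typedef (overloaded) ('a :: metric_space) cpath =
  "{f :: real \<Rightarrow> 'a. continuous_on {0..} f \<and> f \<in> extensional {0..}}"
  morphisms apply_cpath Cpath
  by (rule exI[of _ "restrict (\<lambda>_. undefined) {0..}"]) (auto cong: continuous_on_cong)

setup_lifting type_definition_cpath

text \<open>
  Since \<open>[0,\<infinity>)\<close> is locally compact, locally uniform convergence is uniform convergence on
  compact sets.
\<close>

instantiation cpath :: (metric_space) topological_space
begin

definition open_cpath :: "'a cpath set \<Rightarrow> bool" where
  "open_cpath A \<longleftrightarrow>
     (\<forall>\<omega>\<in>A. \<exists>K e. compact K \<and> K \<subseteq> {0..} \<and> e > 0 \<and>
        {\<eta>. \<forall>s\<in>K. dist (apply_cpath \<eta> s) (apply_cpath \<omega> s) < e} \<subseteq> A)"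

instance
proof
  show "open (UNIV :: 'a cpath set)"
    unfolding open_cpath_def
    by (intro ballI exI[of _ "{}"] exI[of _ "1 :: real"] conjI) simp_all
next
  fix S T :: "'a cpath set"
  assume S: "open S" and T: "open T"
  show "open (S \<inter> T)"
    unfolding open_cpath_def
  proof
    fix \<omega> assume \<omega>: "\<omega> \<in> S \<inter> T"
    from \<omega> have \<omega>S: "\<omega> \<in> S" and \<omega>T: "\<omega> \<in> T" by simp_all
    obtain K e where K: "compact K" "K \<subseteq> {0..}" "e > 0"
      "{\<eta>. \<forall>s\<in>K. dist (apply_cpath \<eta> s) (apply_cpath \<omega> s) < e} \<subseteq> S"
      using bspec[OF S[unfolded open_cpath_def] \<omega>S] by (elim exE conjE) (rule that)
    obtain L e' where L: "compact L" "L \<subseteq> {0..}" "e' > 0"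
      "{\<eta>. \<forall>s\<in>L. dist (apply_cpath \<eta> s) (apply_cpath \<omega> s) < e'} \<subseteq> T"
      using bspec[OF T[unfolded open_cpath_def] \<omega>T] by (elim exE conjE) (rule that)
    have "compact (K \<union> L)" "K \<union> L \<subseteq> {0..}" "min e e' > 0"
      using K L by auto
    moreover have "{\<eta>. \<forall>s\<in>K \<union> L. dist (apply_cpath \<eta> s) (apply_cpath \<omega> s) < min e e'} \<subseteq> S \<inter> T"
      using K(4) L(4) by auto
    ultimately show "\<exists>K e. compact K \<and> K \<subseteq> {0..} \<and> e > 0 \<and>
        {\<eta>. \<forall>s\<in>K. dist (apply_cpath \<eta> s) (apply_cpath \<omega> s) < e} \<subseteq> S \<inter> T"
      by (intro exI conjI)
  qed
next
  fix \<K> :: "'a cpath set set"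
  assume \<K>: "\<forall>S\<in>\<K>. open S"
  show "open (\<Union>\<K>)"
    unfolding open_cpath_def
  proof
    fix \<omega> assume "\<omega> \<in> \<Union>\<K>"
    then obtain S where S: "S \<in> \<K>" "\<omega> \<in> S" by blast
    with \<K> have oS: "open S" by blast
    obtain K e where K: "compact K" "K \<subseteq> {0..}" "e > 0"
      "{\<eta>. \<forall>s\<in>K. dist (apply_cpath \<eta> s) (apply_cpath \<omega> s) < e} \<subseteq> S"
      using bspec[OF oS[unfolded open_cpath_def] S(2)] by (elim exE conjE) (rule that)
    from K(4) Union_upper[OF S(1)]
    have "{\<eta>. \<forall>s\<in>K. dist (apply_cpath \<eta> s) (apply_cpath \<omega> s) < e} \<subseteq> \<Union>\<K>"
      by (rule order_trans)
    with K(1-3) show "\<exists>K e. compact K \<and> K \<subseteq> {0..} \<and> e > 0 \<and>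
        {\<eta>. \<forall>s\<in>K. dist (apply_cpath \<eta> s) (apply_cpath \<omega> s) < e} \<subseteq> \<Union>\<K>"
      by (intro exI conjI)
  qed
qed

end

definition \<Omega>\<^sub>0 :: "(real ^ 'd) cpath set" where
  "\<Omega>\<^sub>0 = {\<omega>. apply_cpath \<omega> 0 = 0}"

text \<open>The stopped path \<open>\<omega>(r \<and> \<cdot>)\<close>, for \<open>r \<ge> 0\<close>; the \<open>max\<close> only makes it total in \<open>r\<close>.\<close>

lift_definition stopped :: "real \<Rightarrow> ('a :: metric_space) cpath \<Rightarrow> 'a cpath"
  is "\<lambda>r \<omega>. restrict (\<lambda>s. \<omega> (min (max 0 r) s)) {0..}"
proof -
  fix r :: real and f :: "real \<Rightarrow> 'a"
  assume f: "continuous_on {0..} f \<and> f \<in> extensional {0..}"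
  have "continuous_on {0..} (\<lambda>s. f (min (max 0 r) s))"
    by (rule continuous_on_compose2[of "{0..}" f]) (use f in \<open>auto intro!: continuous_intros\<close>)
  then have "continuous_on {0..} (restrict (\<lambda>s. f (min (max 0 r) s)) {0..})"
    by (subst continuous_on_cong[OF refl]) simp_all
  then show "continuous_on {0..} (restrict (\<lambda>s. f (min (max 0 r) s)) {0..}) \<and>
      restrict (\<lambda>s. f (min (max 0 r) s)) {0..} \<in> extensional {0..}"
    by (simp only: restrict_extensional)
qed

lemma apply_stopped:
  assumes "0 \<le> r" "0 \<le> s"
  shows "apply_cpath (stopped r \<omega>) s = apply_cpath \<omega> (min r s)"
  using assms by transfer (simp add: max_def)


section \<open>Weak convergence of probability measures\<close>

definition borel_probs :: "'a :: topological_space set \<Rightarrow> 'a measure set" where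
  "borel_probs S = {\<mu>. prob_space \<mu> \<and> sets \<mu> = sets (restrict_space borel S)}"

definition weak_topology :: "'a :: topological_space set \<Rightarrow> 'a measure topology" where
  "weak_topology S = topology_generated_by
     {{\<mu> \<in> borel_probs S. (\<integral>x. f x \<partial>\<mu>) \<in> V} | (f :: 'a \<Rightarrow> real) V.
        continuous_on S f \<and> bounded (f ` S) \<and> open V}"

lemma topspace_weak_topology: "topspace (weak_topology S) = borel_probs S"
proof
  show "topspace (weak_topology S) \<subseteq> borel_probs S"
    unfolding weak_topology_def topology_generated_by_topspace by auto
  have "borel_probs S = {\<mu> \<in> borel_probs S. (\<integral>x. (\<lambda>_. 0 :: real) x \<partial>\<mu>) \<in> UNIV}"
    by simp
  moreover have "continuous_on S (\<lambda>_. 0 :: real)" "open (UNIV :: real set)"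
    by simp_all
  moreover have "bounded ((\<lambda>_. 0 :: real) ` S)"
    by (rule bounded_subset[of "{0}"]) auto
  ultimately have "openin (weak_topology S) (borel_probs S)"
    unfolding weak_topology_def by (intro topology_generated_by_Basis CollectI exI conjI)
  then show "borel_probs S \<subseteq> topspace (weak_topology S)"
    by (rule openin_subset)
qed


section \<open>The space of controls\<close>

text \<open>\<open>L\<^sup>0([0,\<infinity>); 'u)\<close>; the values of a representative on \<open>(-\<infinity>,0)\<close> are irrelevant.\<close>

definition ctrl_rel :: "(real \<Rightarrow> 'u :: topological_space) \<Rightarrow> (real \<Rightarrow> 'u) \<Rightarrow> bool" where
  "ctrl_rel u v \<longleftrightarrow>
     u \<in> borel_measurable (restrict_space borel {0..}) \<and>
     v \<in> borel_measurable (restrict_space borel {0..}) \<and>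
     (AE t in lborel. 0 \<le> t \<longrightarrow> u t = v t)"

quotient_type (overloaded) 'u ctrl = "real \<Rightarrow> ('u :: polish_space)" / partial: ctrl_rel
proof (rule part_equivpI)
  show "\<exists>u :: real \<Rightarrow> 'u. ctrl_rel u u"
    by (rule exI[of _ "\<lambda>_. undefined"]) (simp add: ctrl_rel_def)
  show "symp (ctrl_rel :: (real \<Rightarrow> 'u) \<Rightarrow> _)"
    by (rule sympI) (auto simp: ctrl_rel_def elim!: eventually_mono)
  show "transp (ctrl_rel :: (real \<Rightarrow> 'u) \<Rightarrow> _)"
  proof (rule transpI)
    fix u v w :: "real \<Rightarrow> 'u"
    assume uv: "ctrl_rel u v" and vw: "ctrl_rel v w"
    from uv have "AE t in lborel. 0 \<le> t \<longrightarrow> u t = v t" by (simp add: ctrl_rel_def)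
    moreover from vw have "AE t in lborel. 0 \<le> t \<longrightarrow> v t = w t" by (simp add: ctrl_rel_def)
    ultimately have "AE t in lborel. 0 \<le> t \<longrightarrow> u t = w t" by eventually_elim simp
    with uv vw show "ctrl_rel u w" by (simp add: ctrl_rel_def)
  qed
qed

text \<open>
  The measure \<open>e\<^sup>-\<^sup>t \<delta>\<^bsub>u(t)\<^esub>(dx) dt\<close> on \<open>[0,\<infinity>) \<times> 'u\<close>, as the image of \<open>e\<^sup>-\<^sup>t dt\<close> under
  \<open>t \<mapsto> (t, u(t))\<close>; the disintegrated form is the lemma \<open>emeasure_ctrl_measure\<close>.
\<close>

definition graph_measure :: "(real \<Rightarrow> 'u :: topological_space) \<Rightarrow> (real \<times> 'u) measure" where
  "graph_measure u =
     distr (density (restrict_space lborel {0..}) (\<lambda>t. ennreal (exp (- t))))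
       (restrict_space borel ({0..} \<times> UNIV)) (\<lambda>t. (t, u t))"

lemma measurable_graph [measurable]:
  fixes u :: "real \<Rightarrow> 'u :: polish_space"
  assumes [measurable]: "u \<in> borel_measurable (restrict_space borel {0..})"
  shows "(\<lambda>t. (t, u t)) \<in> measurable (density (restrict_space lborel {0..}) f)
           (restrict_space borel ({0..} \<times> UNIV))"
proof -
  have "(\<lambda>t. t) \<in> borel_measurable (restrict_space borel {0..})"
    by (rule measurable_restrict_space1) simp
  then have "(\<lambda>t. (t, u t)) \<in> measurable (restrict_space borel {0..}) (borel \<Otimes>\<^sub>M borel)"
    by measurable
  then have "(\<lambda>t. (t, u t)) \<in> measurable (restrict_space borel {0..}) borel"
    by (simp add: borel_prod)
  then have "(\<lambda>t. (t, u t)) \<in> measurable (restrict_space borel {0..})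
               (restrict_space borel ({0..} \<times> UNIV))"
    by (intro measurable_restrict_space2) (auto simp: space_restrict_space)
  moreover have "sets (density (restrict_space lborel {0..}) f) = sets (restrict_space borel {0..})"
    by (simp add: sets_restrict_space)
  ultimately show ?thesis by (simp cong: measurable_cong_sets)
qed

lift_definition ctrl_measure :: "'u :: polish_space ctrl \<Rightarrow> (real \<times> 'u) measure"
  is graph_measure
proof -
  fix u v :: "real \<Rightarrow> 'u"
  assume uv: "ctrl_rel u v"
  then have "AE t in restrict_space lborel {0..}. u t = v t"
    by (simp add: ctrl_rel_def AE_restrict_space_iff)
  then have "AE t in density (restrict_space lborel {0..}) (\<lambda>t. ennreal (exp (- t))). (t, u t) = (t, v t)"
    by (subst AE_density) (auto intro!: measurable_restrict_space1)
  with uv show "graph_measure u = graph_measure v"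
    unfolding graph_measure_def
    by (intro distr_cong_AE) (auto simp: ctrl_rel_def intro!: measurable_graph)
qed

lemma emeasure_graph_measure:
  fixes u :: "real \<Rightarrow> 'u :: polish_space"
  assumes u: "u \<in> borel_measurable (restrict_space borel {0..})"
    and A: "A \<in> sets (restrict_space borel ({0..} \<times> UNIV))"
  shows "emeasure (graph_measure u) A =
    (\<integral>\<^sup>+t\<in>{0..}. ennreal (exp (- t)) * emeasure (return borel (u t)) {x. (t, x) \<in> A} \<partial>lborel)"
proof -
  let ?D = "density (restrict_space lborel {0..}) (\<lambda>t. ennreal (exp (- t)))"
  have e: "(\<lambda>t. ennreal (exp (- t))) \<in> borel_measurable (restrict_space lborel {0..})"
    by (rule measurable_restrict_space1) simp
  have g: "(\<lambda>t. (t, u t)) \<in> measurable ?D (restrict_space borel ({0..} \<times> UNIV))"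
    by (rule measurable_graph[OF u])
  have B: "(\<lambda>t. (t, u t)) -` A \<inter> space ?D \<in> sets (restrict_space lborel {0..})"
    using measurable_sets[OF g A] by simp
  have A': "A \<in> sets borel"
  proof -
    have "({0..} \<times> UNIV :: (real \<times> 'u) set) \<in> sets borel"
      by (intro borel_closed closed_Times) auto
    with A show ?thesis by (auto simp: sets_restrict_space)
  qed
  have slice: "{x. (t, x) \<in> A} \<in> sets borel" for t
    using measurable_sets[OF measurable_Pair1', of t borel A borel] A'
    by (simp add: borel_prod vimage_def)
  have "emeasure (graph_measure u) A = emeasure ?D ((\<lambda>t. (t, u t)) -` A \<inter> space ?D)"
    unfolding graph_measure_def by (rule emeasure_distr[OF g A])
  also have "\<dots> = (\<integral>\<^sup>+t. ennreal (exp (- t)) * indicator ((\<lambda>t. (t, u t)) -` A \<inter> space ?D) t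
                    \<partial>restrict_space lborel {0..})"
    by (rule emeasure_density[OF e B])
  also have "\<dots> = (\<integral>\<^sup>+t\<in>{0..}. ennreal (exp (- t)) * indicator ((\<lambda>t. (t, u t)) -` A \<inter> space ?D) t \<partial>lborel)"
    by (rule nn_integral_restrict_space) simp
  also have "\<dots> = (\<integral>\<^sup>+t\<in>{0..}. ennreal (exp (- t)) * emeasure (return borel (u t)) {x. (t, x) \<in> A} \<partial>lborel)"
    by (rule nn_integral_cong)
       (auto simp: slice space_restrict_space split: split_indicator)
  finally show ?thesis .
qed

lemma prob_space_graph_measure:
  fixes u :: "real \<Rightarrow> 'u :: polish_space"
  assumes u: "u \<in> borel_measurable (restrict_space borel {0..})"
  shows "prob_space (graph_measure u)"
proof -
  have "prob_space (density (restrict_space lborel {0..}) (\<lambda>t. ennreal (exp (- t))))"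
  proof
    have e: "(\<lambda>t. ennreal (exp (- t))) \<in> borel_measurable (restrict_space lborel {0..})"
      by (rule measurable_restrict_space1) simp
    have "emeasure (density (restrict_space lborel {0..}) (\<lambda>t. ennreal (exp (- t))))
            (space (density (restrict_space lborel {0..}) (\<lambda>t. ennreal (exp (- t)))))
          = (\<integral>\<^sup>+t. ennreal (exp (- t)) * indicator (space (restrict_space lborel {0..})) t
               \<partial>restrict_space lborel {0..})"
      unfolding space_density by (rule emeasure_density[OF e sets.top])
    also have "\<dots> = (\<integral>\<^sup>+t. ennreal (exp (- t)) \<partial>restrict_space lborel {0..})"
      by (rule nn_integral_cong) simp
    also have "\<dots> = (\<integral>\<^sup>+t\<in>{0..}. ennreal (exp (- t)) \<partial>lborel)"
      by (rule nn_integral_restrict_space) simp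
    also have "\<dots> = 1"
      using nn_intergal_power_times_exp_Ici[of 0] by simp
    finally show "emeasure (density (restrict_space lborel {0..}) (\<lambda>t. ennreal (exp (- t))))
            (space (density (restrict_space lborel {0..}) (\<lambda>t. ennreal (exp (- t))))) = 1" .
  qed
  then show ?thesis
    unfolding graph_measure_def by (rule prob_space.prob_space_distr) (rule measurable_graph[OF u])
qed

lemma ctrl_measure_in_borel_probs: "ctrl_measure u \<in> borel_probs ({0..} \<times> UNIV)"
  by transfer (auto simp: borel_probs_def ctrl_rel_def prob_space_graph_measure, simp_all add: graph_measure_def)

lemma emeasure_ctrl_measure:
  fixes u :: "real \<Rightarrow> 'u :: polish_space"
  assumes "u \<in> borel_measurable (restrict_space borel {0..})"
    and "A \<in> sets (restrict_space borel ({0..} \<times> UNIV))"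
  shows "emeasure (ctrl_measure (abs_ctrl u)) A =
    (\<integral>\<^sup>+t\<in>{0..}. ennreal (exp (- t)) * emeasure (return borel (u t)) {x. (t, x) \<in> A} \<partial>lborel)"
proof -
  have "ctrl_measure (abs_ctrl u) = graph_measure u"
    by (rule ctrl_measure.abs_eq) (use assms in \<open>simp add: ctrl_rel_def\<close>)
  with emeasure_graph_measure[OF assms] show ?thesis by simp
qed

instantiation ctrl :: (polish_space) topological_space
begin

definition open_ctrl :: "'a ctrl set \<Rightarrow> bool" where
  "open_ctrl A \<longleftrightarrow>
     openin (pullback_topology UNIV ctrl_measure (weak_topology ({0..} \<times> UNIV))) A"

instance
proof
  have "topspace (pullback_topology UNIV ctrl_measure (weak_topology ({0..} \<times> (UNIV :: 'a set)))) = UNIV"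
    by (auto simp: topspace_pullback_topology topspace_weak_topology ctrl_measure_in_borel_probs)
  then show "open (UNIV :: 'a ctrl set)"
    unfolding open_ctrl_def by (metis openin_topspace)
next
  show "open (S \<inter> T)" if "open S" "open T" for S T :: "'a ctrl set"
    using that unfolding open_ctrl_def by (rule openin_Int)
next
  show "open (\<Union>\<K>)" if "\<forall>S\<in>\<K>. open S" for \<K> :: "'a ctrl set set"
    using that unfolding open_ctrl_def by (intro openin_Union) blast
qed

end

text \<open>
  The integral of \<open>f(r, u(r))\<close> over \<open>r \<in> S\<close>, for \<open>S \<subseteq> [0,\<infinity>)\<close> and \<open>f\<close> given on \<open>(0,\<infinity>)\<close>.
  Intersecting with \<open>(0,\<infinity>)\<close> at most drops the null set \<open>{0}\<close>.
\<close>

lift_definition ctrl_integral ::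
    "real set \<Rightarrow> (real \<Rightarrow> 'u \<Rightarrow> ereal) \<Rightarrow> 'u :: polish_space ctrl \<Rightarrow> ereal"
  is "\<lambda>S f u. ext_integral lborel (\<lambda>r. if r \<in> S \<inter> {0<..} then f r (u r) else 0)"
  by (rule ext_integral_cong_AE) (auto simp: ctrl_rel_def elim!: eventually_mono)

definition I_fun :: "(real \<times> 'u \<Rightarrow> real) \<Rightarrow> 'u :: polish_space ctrl \<Rightarrow> ereal" where
  "I_fun \<phi> u = ctrl_integral {0<..} (\<lambda>s x. ereal (\<phi> (s, x))) u"

end

theory Submission
  imports Defs
begin

text \<open>
  Since \<open>e\<^sup>t\<close> cancels the density of \<^const>\<open>ctrl_measure\<close>, every integral along a control \<open>u\<close> is
  an integral against \<^term>\<open>ctrl_measure u\<close>.  A nonnegative lower semicontinuous function on a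
  separable metric space is the supremum of the finite maxima of truncated cones
  \<open>max 0 (q - n \<cdot> dist x c)\<close> below it, with \<open>q\<close> rational and \<open>c\<close> in a countable dense set.
  Consequently the integrals of these countably many continuous functions determine the weak
  topology, which is therefore second countable, and they also show that \<^const>\<open>ctrl_measure\<close>
  is a Borel probability kernel.  Second countability puts every open set of controls
  into the sigma-field generated by the functionals \<open>I\<^sub>\<phi>\<close>; integrating against the kernel gives
  the measurability of \<open>I\<^sub>\<phi>\<close>.  For the path functional, the path spaces are second countable as
  well, so that Borel sets of products are product measurable, and evaluation and stopping are
  jointly continuous in time and path.
\<close>

section \<open>Second countability of the path spaces\<close>

lemma open_generate_topology:
  assumes "generate_topology \<S> A" "\<And>S. S \<in> \<S> \<Longrightarrow> open S"
  shows "open A"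
  using assms by (induction rule: generate_topology.induct) auto

lemma generate_topology_trans:
  assumes "generate_topology \<B> A" "\<And>B. B \<in> \<B> \<Longrightarrow> generate_topology \<S> B"
  shows "generate_topology \<S> A"
  using assms by (induction rule: generate_topology.induct) (auto intro: generate_topology.intros)

lemma generate_topologyI:
  assumes "\<And>x. x \<in> A \<Longrightarrow> \<exists>T. generate_topology \<S> T \<and> x \<in> T \<and> T \<subseteq> A"
  shows "generate_topology \<S> A"
proof -
  have "A = \<Union>{T. generate_topology \<S> T \<and> T \<subseteq> A}"
    using assms by blast
  then show ?thesis
    by (metis (mono_tags, lifting) generate_topology.UN mem_Collect_eq)
qed

lemma generate_topology_INT:
  assumes "finite I" "\<And>i. i \<in> I \<Longrightarrow> generate_topology \<S> (F i)"
  shows "generate_topology \<S> (\<Inter>i\<in>I. F i)"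
  using assms
  by (induction rule: finite_induct) (auto intro: generate_topology.UNIV generate_topology.Int)

text \<open>The family \<open>\<S>\<close> may be uncountable. Second countability of the type makes
  every union of open sets a countable union, by Lindelof, and finite intersections are no
  obstacle.\<close>

lemma borel_eq_sigma_generate_topology:
  assumes "open = generate_topology (\<S> :: 'a :: second_countable_topology set set)"
  shows "borel = sigma UNIV \<S>"
  unfolding borel_def
proof (rule sigma_eqI)
  have "A \<in> sets (sigma UNIV \<S>)" if "generate_topology \<S> A" for A
    using that
  proof (induction rule: generate_topology.induct)
    case UNIV
    show ?case using sets.top[of "sigma UNIV \<S>"] by (simp add: space_measure_of_conv)
  next
    case (UN K)
    then have "\<And>S. S \<in> K \<Longrightarrow> open S" by (simp add: assms)
    then obtain K' where K': "K' \<subseteq> K" "countable K'" "\<Union>K' = \<Union>K"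
      by (rule Lindelof)
    have "\<Union>K' \<in> sets (sigma UNIV \<S>)"
      using K' UN.IH by (intro sets.countable_Union) auto
    with K' show ?case by simp
  qed (use sets.Int[of _ "sigma UNIV \<S>"] in \<open>auto simp: sets_measure_of_conv\<close>)
  then have "A \<in> sigma_sets UNIV \<S>" if "generate_topology \<S> A" for A
    using that by (simp add: sets_measure_of_conv)
  then show "sigma_sets UNIV {S. open S} = sigma_sets UNIV \<S>"
    by (intro sigma_sets_eqI) (simp_all add: assms generate_topology.Basis sigma_sets.Basic)
qed simp_all

section \<open>Uniform neighbourhoods and limits of paths\<close>

lemma open_cpath_uniform_ball:
  fixes g :: "real \<Rightarrow> 'a :: metric_space"
  assumes K: "compact K" "K \<subseteq> {0..}" and g: "continuous_on K g"
  shows "open {\<eta>. \<forall>s\<in>K. dist (apply_cpath \<eta> s) (g s) < e}"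
  unfolding open_cpath_def
proof (intro ballI)
  fix \<omega> assume \<omega>: "\<omega> \<in> {\<eta>. \<forall>s\<in>K. dist (apply_cpath \<eta> s) (g s) < e}"
  show "\<exists>L d. compact L \<and> L \<subseteq> {0..} \<and> d > 0 \<and>
      {\<eta>. \<forall>s\<in>L. dist (apply_cpath \<eta> s) (apply_cpath \<omega> s) < d}
        \<subseteq> {\<eta>. \<forall>s\<in>K. dist (apply_cpath \<eta> s) (g s) < e}"
  proof (cases "K = {}")
    case True
    then show ?thesis by (intro exI[of _ "{}"] exI[of _ "1 :: real"]) auto
  next
    case False
    have "continuous_on K (apply_cpath \<omega>)"
      using apply_cpath[of \<omega>] K(2) by (auto intro: continuous_on_subset)
    then have "continuous_on K (\<lambda>s. dist (apply_cpath \<omega> s) (g s))"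
      using g by (intro continuous_intros)
    \<comment> \<open>The distance to the centre attains its maximum on the nonempty compact set, so
      a single margin \<open>d\<close> serves all times in \<open>K\<close>.\<close>
    with K(1) False obtain s0 where s0: "s0 \<in> K"
      "\<And>s. s \<in> K \<Longrightarrow> dist (apply_cpath \<omega> s) (g s) \<le> dist (apply_cpath \<omega> s0) (g s0)"
      using continuous_attains_sup[of K] by blast
    define d where "d = e - dist (apply_cpath \<omega> s0) (g s0)"
    have "d > 0" using \<omega> s0 by (simp add: d_def)
    moreover have "dist (apply_cpath \<eta> s) (g s) < e"
      if "dist (apply_cpath \<eta> s) (apply_cpath \<omega> s) < d" "s \<in> K" for \<eta> s
      using that s0(2)[of s] dist_triangle[of "apply_cpath \<eta> s" "g s" "apply_cpath \<omega> s"]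
      by (simp add: d_def)
    ultimately show ?thesis using K by (intro exI[of _ K] exI[of _ d]) auto
  qed
qed

lemma continuous_on_apply_cpath: "continuous_on {0..} (apply_cpath \<omega>)"
  using apply_cpath[of \<omega>] by simp

text \<open>Every compact subset of the half-line lies in some interval from 0 to \<open>b\<close>,
  so these intervals alone describe the neighbourhoods of a path.\<close>

lemma open_cpathE:
  fixes \<omega> :: "'a :: metric_space cpath"
  assumes A: "open A" and \<omega>: "\<omega> \<in> A"
  obtains b e where "b > 0" "e > 0"
    "{\<eta>. \<forall>s\<in>{0..b}. dist (apply_cpath \<eta> s) (apply_cpath \<omega> s) < e} \<subseteq> A"
proof -
  from bspec[OF A[unfolded open_cpath_def] \<omega>]
  obtain K e where K: "compact K" "K \<subseteq> {0..}" "e > 0"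
    "{\<eta>. \<forall>s\<in>K. dist (apply_cpath \<eta> s) (apply_cpath \<omega> s) < e} \<subseteq> A"
    by (elim exE conjE) (rule that)
  obtain b where b: "\<forall>s\<in>K. norm s \<le> b" "b > 0"
    using compact_imp_bounded[OF K(1)] bounded_pos by blast
  then have "K \<subseteq> {0..b}" using K(2) by (force simp: abs_le_iff)
  then have "{\<eta>. \<forall>s\<in>{0..b}. dist (apply_cpath \<eta> s) (apply_cpath \<omega> s) < e} \<subseteq> A"
    by (intro order_trans[OF _ K(4)]) auto
  with b(2) K(3) show ?thesis by (rule that)
qed

lemma tendsto_cpath_iff:
  fixes f :: "'b \<Rightarrow> 'a :: metric_space cpath"
  shows "(f \<longlongrightarrow> \<omega>) F \<longleftrightarrow>
    (\<forall>b \<ge> 0. \<forall>e>0. \<forall>\<^sub>F z in F. \<forall>s\<in>{0..b}. dist (apply_cpath (f z) s) (apply_cpath \<omega> s) < e)"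
proof safe
  fix b e :: real
  assume lim: "(f \<longlongrightarrow> \<omega>) F" and "e > 0"
  have "open {\<eta>. \<forall>s\<in>{0..b}. dist (apply_cpath \<eta> s) (apply_cpath \<omega> s) < e}"
    by (intro open_cpath_uniform_ball continuous_on_subset[OF continuous_on_apply_cpath]) auto
  from topological_tendstoD[OF lim this] \<open>e > 0\<close>
  show "\<forall>\<^sub>F z in F. \<forall>s\<in>{0..b}. dist (apply_cpath (f z) s) (apply_cpath \<omega> s) < e"
    by simp
next
  assume R: "\<forall>b \<ge> 0. \<forall>e>0. \<forall>\<^sub>F z in F. \<forall>s\<in>{0..b}. dist (apply_cpath (f z) s) (apply_cpath \<omega> s) < e"
  show "(f \<longlongrightarrow> \<omega>) F"
  proof (rule topological_tendstoI)
    fix A :: "'a cpath set" assume "open A" "\<omega> \<in> A"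
    then obtain b e where b: "b > 0" "e > 0"
      "{\<eta>. \<forall>s\<in>{0..b}. dist (apply_cpath \<eta> s) (apply_cpath \<omega> s) < e} \<subseteq> A"
      by (rule open_cpathE)
    have "\<forall>\<^sub>F z in F. \<forall>s\<in>{0..b}. dist (apply_cpath (f z) s) (apply_cpath \<omega> s) < e"
      using R b(1,2) by simp
    then show "\<forall>\<^sub>F z in F. f z \<in> A"
      by eventually_elim (use b(3) in auto)
  qed
qed

text \<open>Uniform continuity on compact intervals reduces a uniform ball to finitely many
  conditions \<open>dist (\<omega> s) c < 1 / (k + 1)\<close> on intervals of a grid, with \<open>c\<close> in a countable dense set.\<close>

instance cpath :: ("{metric_space, second_countable_topology}") second_countable_topology
proof
  obtain D :: "'a set" where D: "countable D" "\<And>X. open X \<Longrightarrow> X \<noteq> {} \<Longrightarrow> \<exists>d\<in>D. d \<in> X"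
    using countable_dense_setE by blast
  \<comment> \<open>Each cell belongs to a grid of mesh \<open>1 / (m + 1)\<close>. Natural indices
    and centres in \<open>D\<close> keep the family countable.\<close>
  define W where "W = (\<lambda>(p :: nat, m :: nat, k :: nat, c :: 'a).
    {\<omega>. \<forall>s\<in>{real p / real (Suc m)..real (Suc p) / real (Suc m)}.
      dist (apply_cpath \<omega> s) c < 1 / real (Suc k)})"
  define \<S> where "\<S> = W ` (UNIV \<times> UNIV \<times> UNIV \<times> D)"
  have "countable \<S>" using D(1) by (simp add: \<S>_def)
  moreover have "open A = generate_topology \<S> A" for A :: "'a cpath set"
  proof
    assume "generate_topology \<S> A"
    moreover have "open S" if "S \<in> \<S>" for S
    proof -
      have "open (W (p, m, k, c))" for p m k c
      proof -
        have "0 \<le> real p / real (Suc m)" by simp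
        then have "{real p / real (Suc m)..real (Suc p) / real (Suc m)} \<subseteq> {0..}"
          by (meson atLeastAtMost_iff atLeast_iff order_trans subsetI)
        then show ?thesis
          unfolding W_def prod.case by (intro open_cpath_uniform_ball) simp_all
      qed
      with that show ?thesis by (auto simp: \<S>_def)
    qed
    ultimately show "open A" by (rule open_generate_topology)
  next
    assume A: "open A"
    show "generate_topology \<S> A"
    proof (rule generate_topologyI)
      fix \<omega> assume "\<omega> \<in> A"
      with A obtain b e where b: "b > 0" "e > 0"
        "{\<eta>. \<forall>s\<in>{0..b}. dist (apply_cpath \<eta> s) (apply_cpath \<omega> s) < e} \<subseteq> A"
        by (rule open_cpathE)
      \<comment> \<open>The paths \<open>\<eta>\<close> and \<open>\<omega>\<close> will both stay
        within \<open>1 / (k + 1)\<close> of a common centre, hence within twice that of each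
        other.\<close>
      obtain k where k: "2 / real (Suc k) < e"
        using reals_Archimedean[of "e / 2"] b(2) by (auto simp: field_simps)
      define r where "r = 1 / real (Suc k)"
      have r: "r > 0" "2 * r < e" using k by (simp_all add: r_def)
      \<comment> \<open>The last cell that starts before \<open>b\<close> can end after it, but by
        no more than the mesh, which is at most 1.\<close>
      have "uniformly_continuous_on {0..b + 1} (apply_cpath \<omega>)"
        by (intro compact_uniformly_continuous continuous_on_subset[OF continuous_on_apply_cpath]) auto
      then obtain d where d: "d > 0"
        "\<And>s t. s \<in> {0..b+1} \<Longrightarrow> t \<in> {0..b+1} \<Longrightarrow> dist s t < d \<Longrightarrow>
           dist (apply_cpath \<omega> s) (apply_cpath \<omega> t) < r / 2"
        unfolding uniformly_continuous_on_def using r(1) by (metis half_gt_zero)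
      obtain m where m: "1 / real (Suc m) < d"
        using reals_Archimedean[OF d(1)] by (auto simp: inverse_eq_divide)
      define x where "x p = real p / real (Suc m)" for p
      have "\<exists>c\<in>D. dist (apply_cpath \<omega> (x p)) c < r / 2" for p
        using D(2)[of "ball (apply_cpath \<omega> (x p)) (r / 2)"] r(1) by auto
      then obtain c where c: "\<And>p. c p \<in> D" "\<And>p. dist (apply_cpath \<omega> (x p)) (c p) < r / 2"
        by metis
      define I where "I = {p. x p \<le> b}"
      define T where "T = (\<Inter>p\<in>I. W (p, m, k, c p))"
      have "I \<subseteq> {..nat \<lceil>b * real (Suc m)\<rceil>}"
        unfolding I_def x_def using b(1) by (auto simp: field_simps) linarith
      then have "finite I" by (rule finite_subset) simp
      then have "generate_topology \<S> T"
        unfolding T_def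
        by (intro generate_topology_INT generate_topology.Basis) (auto simp: \<S>_def c)
      moreover have "\<omega> \<in> T"
      proof -
        \<comment> \<open>One half of \<open>r\<close> pays for the distance of the centre from the
          path at the left end of the cell, the other half for the oscillation of the path on the
          cell.\<close>
        have "dist (apply_cpath \<omega> s) (c p) < r" if "p \<in> I" "s \<in> {x p..x (Suc p)}" for p s
        proof -
          have x: "0 \<le> x p" "x p \<le> b" "x (Suc p) = x p + 1 / real (Suc m)"
            using that by (simp_all add: I_def x_def add_divide_distrib)
          have "1 / real (Suc m) \<le> 1" by simp
          with that(2) m x have "s \<le> b + 1" "s - x p < d"
            unfolding atLeastAtMost_iff by linarith+
          then have "dist (apply_cpath \<omega> s) (apply_cpath \<omega> (x p)) < r / 2"
            using that(2) x(1,2) by (intro d(2)) (auto simp: dist_real_def)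
          with c(2)[of p] show ?thesis
            using dist_triangle[of "apply_cpath \<omega> s" "c p" "apply_cpath \<omega> (x p)"] by simp
        qed
        then show ?thesis by (auto simp: T_def W_def x_def r_def)
      qed
      moreover have "T \<subseteq> A"
      proof
        fix \<eta> assume \<eta>: "\<eta> \<in> T"
        have "dist (apply_cpath \<eta> s) (apply_cpath \<omega> s) < e" if s: "s \<in> {0..b}" for s
        proof -
          \<comment> \<open>The index of a cell that contains \<open>s\<close>.\<close>
          define p where "p = nat \<lfloor>s * real (Suc m)\<rfloor>"
          have "real p \<le> s * real (Suc m)" "s * real (Suc m) \<le> real (Suc p)"
            using s by (simp_all add: p_def) linarith
          then have p: "x p \<le> s" "s \<le> x (Suc p)" by (simp_all add: x_def field_simps)
          with s have "p \<in> I" by (simp add: I_def)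
          with p \<eta> \<open>\<omega> \<in> T\<close>
          have "dist (apply_cpath \<eta> s) (c p) < r" "dist (apply_cpath \<omega> s) (c p) < r"
            by (auto simp: T_def W_def x_def r_def)
          with r(2) show ?thesis
            using dist_triangle2[of "apply_cpath \<eta> s" "apply_cpath \<omega> s" "c p"] by simp
        qed
        with b(3) show "\<eta> \<in> A" by blast
      qed
      ultimately show "\<exists>T. generate_topology \<S> T \<and> \<omega> \<in> T \<and> T \<subseteq> A" by blast
    qed
  qed
  ultimately show "\<exists>\<S> :: 'a cpath set set. countable \<S> \<and> open = generate_topology \<S>"
    by blast
qed

section \<open>Joint continuity of evaluation and stopping\<close>

lemma continuous_on_eval_cpath:
  "continuous_on UNIV (\<lambda>(r, \<omega> :: 'a :: metric_space cpath). apply_cpath \<omega> (max 0 r))"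
  unfolding continuous_on_def
proof safe
  fix r0 :: real and \<omega>0 :: "'a cpath"
  show "((\<lambda>(r, \<omega>). apply_cpath \<omega> (max 0 r)) \<longlongrightarrow> apply_cpath \<omega>0 (max 0 r0)) (at (r0, \<omega>0))"
  proof (rule tendstoI)
    fix e :: real assume "e > 0"
    \<comment> \<open>Near \<open>r0\<close> all evaluation times stay below \<open>b\<close>. On
      this interval uniform closeness of the paths costs \<open>e / 2\<close>; continuity of the
      limit path bounds the effect of moving the time by another \<open>e / 2\<close>.\<close>
    define b where "b = max 0 r0 + 1"
    have [tendsto_intros]: "(fst \<longlongrightarrow> r0) (at (r0, \<omega>0))" "(snd \<longlongrightarrow> \<omega>0) (at (r0, \<omega>0))"
      using tendsto_fst[OF tendsto_ident_at] tendsto_snd[OF tendsto_ident_at]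
      by (force simp: id_def)+
    have "\<forall>\<^sub>F z in at (r0, \<omega>0). \<forall>s\<in>{0..b}. dist (apply_cpath (snd z) s) (apply_cpath \<omega>0 s) < e / 2"
      using \<open>(snd \<longlongrightarrow> \<omega>0) _\<close> \<open>e > 0\<close> unfolding tendsto_cpath_iff by (simp add: b_def del: divide_const_simps)
    moreover have "\<forall>\<^sub>F z in at (r0, \<omega>0). fst z < r0 + 1"
      using order_tendstoD(2)[OF \<open>(fst \<longlongrightarrow> r0) _\<close>] by simp
    moreover have "continuous_on UNIV (\<lambda>r. apply_cpath \<omega>0 (max 0 r))"
      by (rule continuous_on_compose2[OF continuous_on_apply_cpath]) (auto intro!: continuous_intros)
    then have "((\<lambda>z. apply_cpath \<omega>0 (max 0 (fst z))) \<longlongrightarrow> apply_cpath \<omega>0 (max 0 r0)) (at (r0, \<omega>0))"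
      by (rule continuous_on_tendsto_compose) (auto intro: tendsto_intros)
    then have "\<forall>\<^sub>F z in at (r0, \<omega>0).
        dist (apply_cpath \<omega>0 (max 0 (fst z))) (apply_cpath \<omega>0 (max 0 r0)) < e / 2"
      using \<open>e > 0\<close> by (simp add: tendsto_iff del: divide_const_simps)
    ultimately show "\<forall>\<^sub>F z in at (r0, \<omega>0).
        dist (case z of (r, \<omega>) \<Rightarrow> apply_cpath \<omega> (max 0 r)) (apply_cpath \<omega>0 (max 0 r0)) < e"
    proof eventually_elim
      case (elim z)
      have "dist (apply_cpath (snd z) (max 0 (fst z))) (apply_cpath \<omega>0 (max 0 (fst z))) < e / 2"
        using elim(1,2) by (auto simp: b_def)
      with elim(3) show ?case
        using dist_triangle[of "apply_cpath (snd z) (max 0 (fst z))" "apply_cpath \<omega>0 (max 0 r0)"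
            "apply_cpath \<omega>0 (max 0 (fst z))"]
        by (simp add: split_beta)
    qed
  qed
qed

text \<open>Capping at \<open>r\<close> instead of \<open>r0\<close> moves a time by at most the
  distance of \<open>r\<close> from \<open>r0\<close> and never beyond \<open>b\<close>. Uniform
  continuity of the limit path therefore bounds the effect of a changed stopping time uniformly on
  the interval.\<close>

lemma continuous_on_stopped:
  "continuous_on UNIV (\<lambda>(r, \<omega> :: 'a :: metric_space cpath). stopped r \<omega>)"
  unfolding continuous_on_def
proof safe
  fix r0 :: real and \<omega>0 :: "'a cpath"
  have apply_stopped': "apply_cpath (stopped r \<omega>) s = apply_cpath \<omega> (min (max 0 r) s)"
    if "0 \<le> s" for r s and \<omega> :: "'a cpath"
    using that by transfer simp
  show "((\<lambda>(r, \<omega>). stopped r \<omega>) \<longlongrightarrow> stopped r0 \<omega>0) (at (r0, \<omega>0))"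
    unfolding tendsto_cpath_iff
  proof (intro allI impI)
    fix b e :: real assume b: "b \<ge> 0" and e: "e > 0"
    have "uniformly_continuous_on {0..b} (apply_cpath \<omega>0)"
      by (intro compact_uniformly_continuous continuous_on_subset[OF continuous_on_apply_cpath]) auto
    then obtain d where d: "d > 0"
      "\<And>s t. s \<in> {0..b} \<Longrightarrow> t \<in> {0..b} \<Longrightarrow> dist s t < d \<Longrightarrow>
         dist (apply_cpath \<omega>0 s) (apply_cpath \<omega>0 t) < e / 2"
      unfolding uniformly_continuous_on_def using e by (metis half_gt_zero)
    have lim: "(fst \<longlongrightarrow> r0) (at (r0, \<omega>0))" "(snd \<longlongrightarrow> \<omega>0) (at (r0, \<omega>0))"
      using tendsto_fst[OF tendsto_ident_at] tendsto_snd[OF tendsto_ident_at]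
      by (force simp: id_def)+
    have "\<forall>\<^sub>F z in at (r0, \<omega>0). \<forall>s\<in>{0..b}. dist (apply_cpath (snd z) s) (apply_cpath \<omega>0 s) < e / 2"
      using lim(2) b e unfolding tendsto_cpath_iff by (simp del: divide_const_simps)
    moreover have "\<forall>\<^sub>F z in at (r0, \<omega>0). dist (fst z) r0 < d"
      using lim(1) d(1) by (simp add: tendsto_iff)
    ultimately show "\<forall>\<^sub>F z in at (r0, \<omega>0). \<forall>s\<in>{0..b}.
        dist (apply_cpath (case z of (r, \<omega>) \<Rightarrow> stopped r \<omega>) s) (apply_cpath (stopped r0 \<omega>0) s) < e"
    proof eventually_elim
      case (elim z)
      show ?case
      proof
        fix s assume s: "s \<in> {0..b}"
        let ?t = "min (max 0 (fst z)) s" and ?u = "min (max 0 r0) s"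
        have "dist (apply_cpath (snd z) ?t) (apply_cpath \<omega>0 ?t) < e / 2"
          using s elim(1) by auto
        moreover have "dist (apply_cpath \<omega>0 ?t) (apply_cpath \<omega>0 ?u) < e / 2"
          using s elim(2) by (intro d(2)) (auto simp: dist_real_def)
        ultimately have "dist (apply_cpath (snd z) ?t) (apply_cpath \<omega>0 ?u) < e"
          using dist_triangle[of "apply_cpath (snd z) ?t" "apply_cpath \<omega>0 ?u" "apply_cpath \<omega>0 ?t"]
          by simp
        with s show "dist (apply_cpath (case z of (r, \<omega>) \<Rightarrow> stopped r \<omega>) s)
            (apply_cpath (stopped r0 \<omega>0) s) < e"
          by (simp add: apply_stopped' split_beta)
      qed
    qed
  qed
qed

section \<open>Maxima of cones and the kernel of a control\<close>

definition tent :: "real \<times> nat \<times> 'a :: metric_space \<Rightarrow> 'a \<Rightarrow> real" where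
  "tent = (\<lambda>(q, n, c) x. max 0 (q - real n * dist x c))"

text \<open>Lists encode finite maxima, so a countable set of cones yields a countable family. The
  value 0 at the empty list is neutral because cones are nonnegative.\<close>

primrec tents :: "(real \<times> nat \<times> 'a :: metric_space) list \<Rightarrow> 'a \<Rightarrow> real" where
  "tents [] x = 0"
| "tents (i # is) x = max (tent i x) (tents is x)"

lemma tents_nonneg: "0 \<le> tents is x"
  by (induction "is") auto

lemma tent_le_tents: "i \<in> set is \<Longrightarrow> tent i x \<le> tents is x"
  by (induction "is") auto

lemma tents_le: "0 \<le> a \<Longrightarrow> (\<And>i. i \<in> set is \<Longrightarrow> tent i x \<le> a) \<Longrightarrow> tents is x \<le> a"
  by (induction "is") auto

lemma tents_mono: "set is \<subseteq> set js \<Longrightarrow> tents is x \<le> tents js x"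
  by (rule tents_le) (auto intro: tents_nonneg tent_le_tents)

lemma continuous_on_tents: "continuous_on A (tents is)"
proof (induction "is")
  case (Cons i "is")
  have "continuous_on A (tent i)"
    unfolding tent_def by (cases i) (auto intro!: continuous_intros)
  with Cons show ?case by (auto intro!: continuous_intros)
qed (simp add: continuous_on_const)

lemma bounded_tents: "bounded (tents is ` A)"
proof -
  have "\<exists>B. \<forall>x. tents is x \<le> B"
  proof (induction "is")
    case (Cons i "is")
    then obtain B where B: "\<And>x. tents is x \<le> B" by blast
    obtain q n c where i: "i = (q, n, c)" by (cases i)
    have "tents (i # is) x \<le> max B \<bar>q\<bar>" for x
    proof -
      have "0 \<le> real n * dist x c" by simp
      then have "q - real n * dist x c \<le> \<bar>q\<bar>" by linarith
      with B[of x] show ?thesis by (auto simp: tent_def i)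
    qed
    then show ?case by blast
  qed auto
  then show ?thesis
    unfolding bounded_iff using tents_nonneg
    by (metis (no_types, lifting) abs_of_nonneg imageE real_norm_def)
qed

text \<open>Near \<open>x\<close> the function stays above some rational \<open>q\<close> larger
  than \<open>a\<close>. A cone of height \<open>q\<close> with centre close to \<open>x\<close>
  fits below it once the slope is steep enough to make the cone vanish before it leaves that
  neighbourhood.\<close>

lemma tent_below_lsc:
  fixes f :: "'a :: metric_space \<Rightarrow> ennreal"
  assumes D: "\<And>X. open X \<Longrightarrow> X \<noteq> {} \<Longrightarrow> \<exists>d\<in>D. d \<in> X"
    and f: "\<And>a. openin (top_of_set S) {x\<in>S. a < f x}"
    and x: "x \<in> S" "a < f x"
  obtains i where "i \<in> \<rat> \<times> UNIV \<times> D" "\<And>y. y \<in> S \<Longrightarrow> ennreal (tent i y) \<le> f y"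
    "a < ennreal (tent i x)"
proof -
  \<comment> \<open>The value \<open>f x\<close> may be infinite; the intermediate \<open>b\<close>
    is finite, which allows \<open>q\<close> to be chosen among the reals.\<close>
  obtain b where b: "a < b" "b < f x" using dense[OF x(2)] by blast
  then have "a < \<infinity>" "b < \<infinity>" using top.not_eq_extremum by fastforce+
  then obtain a' b' where ab: "a = ennreal a'" "b = ennreal b'" "0 \<le> a'" "0 \<le> b'"
    by (cases a; cases b) auto
  with b(1) have "a' < b'" by (simp add: ennreal_less_iff)
  then obtain q where q: "q \<in> \<rat>" "a' < q" "q < b'" using Rats_dense_in_real by blast
  have "x \<in> {x\<in>S. ennreal q < f x}"
    using x(1) q ab b(2) by (auto intro: le_less_trans[of _ "ennreal b'"] ennreal_leI)
  then obtain \<delta> where \<delta>: "\<delta> > 0" "ball x \<delta> \<inter> S \<subseteq> {x\<in>S. ennreal q < f x}"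
    using f[of "ennreal q"] unfolding openin_contains_ball by blast
  \<comment> \<open>With this slope a cone of height \<open>q\<close> has dropped to 0 at distance
    \<open>\<delta> / 2\<close> from its centre.\<close>
  obtain n where n: "2 * q / \<delta> < real n" using reals_Archimedean2 by blast
  have "q > 0" using ab q by simp
  with \<delta>(1) have "2 * q / \<delta> > 0" by simp
  with n have n0: "real n > 0" by linarith
  \<comment> \<open>The first radius keeps the cone above \<open>a\<close> at \<open>x\<close>; the
    second keeps its support within distance \<open>\<delta>\<close> of \<open>x\<close>. The centre
    need not lie in \<open>S\<close>.\<close>
  have "ball x (min ((q - a') / real n) (\<delta> / 2)) \<noteq> {}"
    using n0 q(2) \<delta>(1) by (simp add: not_le)
  from D[OF _ this] obtain c where c: "c \<in> D" "dist x c < (q - a') / real n" "dist x c < \<delta> / 2"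
    by auto
  show thesis
  proof (rule that)
    show "(q, n, c) \<in> \<rat> \<times> UNIV \<times> D" using q c by simp
    have "real n * dist x c < q - a'" using c(2) n0 by (simp add: field_simps)
    then show "a < ennreal (tent (q, n, c) x)"
      using ab by (auto simp: tent_def intro!: ennreal_lessI)
    show "ennreal (tent (q, n, c) y) \<le> f y" if "y \<in> S" for y
    proof (cases "dist y c < \<delta> / 2")
      case True
      with c(3) have "dist x y < \<delta>" using dist_triangle2[of x y c] by simp
      with that \<delta>(2) have "ennreal q \<le> f y" by (auto intro: less_imp_le)
      moreover have "tent (q, n, c) y \<le> q" using \<open>q > 0\<close> by (simp add: tent_def)
      ultimately show ?thesis by (meson ennreal_leI order_trans)
    next
      case False
      have "q < real n * (\<delta> / 2)" using n \<delta>(1) by (simp add: field_simps)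
      also have "\<dots> \<le> real n * dist y c" using False by (intro mult_left_mono) auto
      finally show ?thesis by (simp add: tent_def)
    qed
  qed
qed

lemma borel_measurable_tents:
  assumes "sets \<mu> = sets (restrict_space borel S)"
  shows "tents is \<in> borel_measurable \<mu>"
proof -
  have "tents is \<in> borel_measurable (restrict_space borel S)"
    by (intro borel_measurable_continuous_on_restrict continuous_on_tents)
  with assms show ?thesis by (simp cong: measurable_cong_sets)
qed

text \<open>Enumerate the countably many cones below \<open>f\<close>. The maxima of the first
  \<open>n\<close> of them increase to \<open>f\<close>, so monotone convergence applies. The index
  set on the right does not depend on \<open>\<mu>\<close>, which makes the formula usable for all
  controls at once.\<close>

lemma nn_integral_lsc:
  fixes f :: "'a :: metric_space \<Rightarrow> ennreal"
  assumes D: "countable D" "\<And>X. open X \<Longrightarrow> X \<noteq> {} \<Longrightarrow> \<exists>d\<in>D. d \<in> X"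
    and f: "\<And>a. openin (top_of_set S) {x\<in>S. a < f x}"
    and \<mu>: "sets \<mu> = sets (restrict_space borel S)"
  shows "(\<integral>\<^sup>+x. f x \<partial>\<mu>) =
    (SUP is\<in>{is\<in>lists (\<rat> \<times> UNIV \<times> D). \<forall>x\<in>S. ennreal (tents is x) \<le> f x}.
       \<integral>\<^sup>+x. ennreal (tents is x) \<partial>\<mu>)"
proof (rule antisym)
  have space: "space \<mu> = S"
    using sets_eq_imp_space_eq[OF \<mu>] by (simp add: space_restrict_space)
  let ?J = "{i \<in> \<rat> \<times> UNIV \<times> D. \<forall>x\<in>S. ennreal (tent i x) \<le> f x}"
  \<comment> \<open>The zero cone makes the index set nonempty, as the enumeration requires.\<close>
  obtain d where "d \<in> D" using D(2)[of UNIV] by auto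
  then have "(0, 0, d) \<in> ?J" by (auto simp: tent_def)
  then have ne: "?J \<noteq> {}" by blast
  have "countable ?J"
    using D(1) by (intro countable_subset[OF _ countable_SIGMA[of \<rat> "\<lambda>_. UNIV \<times> D"]])
      (auto simp: countable_rat)
  with ne have "range (from_nat_into ?J) = ?J" by (rule range_from_nat_into)
  then obtain e :: "nat \<Rightarrow> _" where e: "range e = ?J" ..
  define g where "g n x = ennreal (tents (map e [0..<n]) x)" for n x
  have g_le: "g n x \<le> f x" if "x \<in> S" for n x
  proof (cases "f x")
    case (real r)
    have "tents (map e [0..<n]) x \<le> r"
    proof (rule tents_le)
      fix i assume "i \<in> set (map e [0..<n])"
      then have "i \<in> ?J" using e by auto
      with that real show "tent i x \<le> r" by auto
    qed (use real in simp)
    with real show ?thesis by (simp add: g_def ennreal_leI)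
  qed simp
  have "f x = (SUP n. g n x)" if x: "x \<in> S" for x
  proof (rule antisym)
    show "f x \<le> (SUP n. g n x)"
    proof (rule dense_le)
      fix a assume "a < f x"
      then obtain i where i: "i \<in> \<rat> \<times> UNIV \<times> D" "\<And>y. y \<in> S \<Longrightarrow> ennreal (tent i y) \<le> f y"
        "a < ennreal (tent i x)"
        using tent_below_lsc[OF D(2) f x] by metis
      then have "i \<in> ?J" by blast
      then obtain n where n: "i = e n" using e by blast
      \<comment> \<open>The list \<open>[0..<n]\<close> stops before \<open>n\<close>, so
        \<open>e n\<close> enters only at \<open>Suc n\<close>.\<close>
      have "tent i x \<le> tents (map e [0..<Suc n]) x" by (rule tent_le_tents) (simp add: n)
      then have "a \<le> g (Suc n) x"
        using i(3) by (auto simp: g_def intro: order_trans[OF less_imp_le ennreal_leI])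
      then show "a \<le> (SUP n. g n x)" by (rule SUP_upper2[OF UNIV_I])
    qed
    show "(SUP n. g n x) \<le> f x" by (rule SUP_least) (rule g_le[OF x])
  qed
  then have "(\<integral>\<^sup>+x. f x \<partial>\<mu>) = (\<integral>\<^sup>+x. (SUP n. g n x) \<partial>\<mu>)"
    by (intro nn_integral_cong) (simp add: space)
  also have "\<dots> = (SUP n. \<integral>\<^sup>+x. g n x \<partial>\<mu>)"
  proof (rule nn_integral_monotone_convergence_SUP)
    show "incseq g"
      by (auto simp: incseq_def le_fun_def g_def intro!: ennreal_leI tents_mono)
    show "g n \<in> borel_measurable \<mu>" for n
      unfolding g_def by (intro measurable_compose[OF borel_measurable_tents[OF \<mu>]] measurable_ennreal)
  qed
  also have "\<dots> \<le> (SUP is\<in>{is\<in>lists (\<rat> \<times> UNIV \<times> D). \<forall>x\<in>S. ennreal (tents is x) \<le> f x}.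
       \<integral>\<^sup>+x. ennreal (tents is x) \<partial>\<mu>)"
  proof (rule SUP_least)
    fix n
    have "set (map e [0..<n]) \<subseteq> range e" by auto
    also have "\<dots> \<subseteq> \<rat> \<times> UNIV \<times> D" unfolding e by blast
    finally have "map e [0..<n] \<in> lists (\<rat> \<times> UNIV \<times> D)" by (simp only: lists_eq_set mem_Collect_eq)
    with g_le show "(\<integral>\<^sup>+x. g n x \<partial>\<mu>) \<le>
      (SUP is\<in>{is\<in>lists (\<rat> \<times> UNIV \<times> D). \<forall>x\<in>S. ennreal (tents is x) \<le> f x}.
       \<integral>\<^sup>+x. ennreal (tents is x) \<partial>\<mu>)"
      by (intro SUP_upper2[of "map e [0..<n]"]) (auto simp: g_def)
  qed
  finally show "(\<integral>\<^sup>+x. f x \<partial>\<mu>) \<le> \<dots>" .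
  show "\<dots> \<le> (\<integral>\<^sup>+x. f x \<partial>\<mu>)"
    by (rule SUP_least) (auto intro!: nn_integral_mono simp: space)
qed

section \<open>Controls as a Borel probability kernel\<close>

lemma borel_probs_integrable:
  fixes f :: "'a :: topological_space \<Rightarrow> real"
  assumes \<mu>: "\<mu> \<in> borel_probs S" and f: "continuous_on S f" "bounded (f ` S)"
  shows "integrable \<mu> f"
proof -
  interpret prob_space \<mu> using \<mu> by (simp add: borel_probs_def)
  have sets: "sets \<mu> = sets (restrict_space borel S)" using \<mu> by (simp add: borel_probs_def)
  then have space: "space \<mu> = S"
    using sets_eq_imp_space_eq[OF sets] by (simp add: space_restrict_space)
  obtain B where "\<forall>x\<in>S. norm (f x) \<le> B" using f(2) by (auto simp: bounded_iff)
  moreover have "f \<in> borel_measurable \<mu>"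
    using borel_measurable_continuous_on_restrict[OF f(1)] sets by (simp cong: measurable_cong_sets)
  ultimately show ?thesis
    by (intro integrable_const_bound[of _ B]) (auto simp: space)
qed

lemma nn_integral_tents:
  assumes "\<mu> \<in> borel_probs S"
  shows "(\<integral>\<^sup>+x. ennreal (tents is x) \<partial>\<mu>) = ennreal (\<integral>x. tents is x \<partial>\<mu>)"
  using borel_probs_integrable[OF assms continuous_on_tents bounded_tents]
  by (intro nn_integral_eq_integral) (auto simp: tents_nonneg)

lemma open_ctrl_integral:
  fixes f :: "real \<times> 'u :: polish_space \<Rightarrow> real"
  assumes "continuous_on ({0..} \<times> UNIV) f" "bounded (f ` ({0..} \<times> UNIV))" "open V"
  shows "open {u. (\<integral>x. f x \<partial>ctrl_measure u) \<in> V}"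
  unfolding open_ctrl_def openin_pullback_topology
proof (intro exI conjI)
  let ?U = "{\<mu> \<in> borel_probs ({0..} \<times> UNIV). (\<integral>x. f x \<partial>\<mu>) \<in> V}"
  show "openin (weak_topology ({0..} \<times> UNIV)) ?U"
    unfolding weak_topology_def using assms by (intro topology_generated_by_Basis) blast
  show "{u. (\<integral>x. f x \<partial>ctrl_measure u) \<in> V} = ctrl_measure -` ?U \<inter> UNIV"
    by (auto simp: ctrl_measure_in_borel_probs)
qed

lemma borel_measurable_ctrl_integral_continuous:
  fixes f :: "real \<times> 'u :: polish_space \<Rightarrow> real"
  assumes "continuous_on ({0..} \<times> UNIV) f" "bounded (f ` ({0..} \<times> UNIV))"
  shows "(\<lambda>u. \<integral>x. f x \<partial>ctrl_measure u) \<in> borel_measurable borel"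
  using open_ctrl_integral[OF assms] by (intro borel_measurableI) (auto simp: vimage_def)

lemma sets_ctrl_measure:
  "sets (ctrl_measure (u :: 'u :: polish_space ctrl)) = sets (restrict_space borel ({0..} \<times> UNIV))"
  using ctrl_measure_in_borel_probs[of u] by (simp add: borel_probs_def)

lemma space_ctrl_measure: "space (ctrl_measure (u :: 'u :: polish_space ctrl)) = {0..} \<times> UNIV"
  using sets_eq_imp_space_eq[OF sets_ctrl_measure] by (auto simp: space_restrict_space)

text \<open>Relatively open sets form an intersection-stable generator. Their indicators are lower
  semicontinuous, so the mass of such a set is a countable supremum of integrals of continuous
  functions, each continuous in the control.\<close>

lemma measurable_ctrl_measure [measurable]:
  "(ctrl_measure :: 'u :: polish_space ctrl \<Rightarrow> _)
     \<in> measurable borel (subprob_algebra (restrict_space borel ({0..} \<times> UNIV)))"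
proof -
  let ?S = "{0..} \<times> UNIV :: (real \<times> 'u) set"
  obtain D :: "(real \<times> 'u) set" where
    D: "countable D" "\<And>X. open X \<Longrightarrow> X \<noteq> {} \<Longrightarrow> \<exists>d\<in>D. d \<in> X"
    using countable_dense_setE by blast
  have S: "?S \<in> sigma_sets UNIV {U. open U}"
    using borel_closed[of ?S] by (simp add: borel_def closed_Times)
  have prob: "prob_space (ctrl_measure u)" for u :: "'u ctrl"
    using ctrl_measure_in_borel_probs[of u] by (simp add: borel_probs_def)
  show ?thesis
  proof (rule measurable_subprob_algebra_generated)
    show "sets (restrict_space borel ?S) = sigma_sets ?S ((\<inter>) ?S ` {U. open U})"
      unfolding sets_restrict_space using sigma_sets_Int[OF S] by (simp add: borel_def)
    show "Int_stable ((\<inter>) ?S ` {U. open U})"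
    proof (rule Int_stableI)
      fix A B assume "A \<in> (\<inter>) ?S ` {U. open U}" "B \<in> (\<inter>) ?S ` {U. open U}"
      then obtain U V where UV: "open U" "open V" "A = ?S \<inter> U" "B = ?S \<inter> V" by blast
      then have "A \<inter> B = ?S \<inter> (U \<inter> V)" by blast
      with UV(1,2) show "A \<inter> B \<in> (\<inter>) ?S ` {U. open U}" by blast
    qed
    show "subprob_space (ctrl_measure u)" for u :: "'u ctrl"
      using prob by (rule prob_space_imp_subprob_space)
    show "(\<lambda>u :: 'u ctrl. emeasure (ctrl_measure u) ?S) \<in> borel_measurable borel"
      using prob_space.emeasure_space_1[OF prob] by (simp add: space_ctrl_measure)
  next
    fix A assume "A \<in> (\<inter>) ?S ` {U. open U}"
    then obtain U where U: "open U" and A: "A = ?S \<inter> U" by blast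
    let ?I = "{is\<in>lists (\<rat> \<times> UNIV \<times> D). \<forall>x\<in>?S. ennreal (tents is x) \<le> indicator A x}"
    have lsc: "openin (top_of_set ?S) {x\<in>?S. a < (indicator A x :: ennreal)}" for a
    proof (cases "a < 1")
      case True
      then have "{x\<in>?S. a < (indicator A x :: ennreal)} = ?S \<inter> (if a < 0 then UNIV else U)"
        by (auto simp: A split: split_indicator)
      with U show ?thesis by auto
    next
      case False
      then have "{x\<in>?S. a < (indicator A x :: ennreal)} = {}"
        by (auto split: split_indicator_asm)
      then show ?thesis by (simp only: openin_empty)
    qed
    have "emeasure (ctrl_measure u) A = (SUP is\<in>?I. ennreal (\<integral>x. tents is x \<partial>ctrl_measure u))"
      for u :: "'u ctrl"
    proof -
      have "A \<in> sets (ctrl_measure u)"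
        using U by (auto simp: sets_ctrl_measure sets_restrict_space A)
      then have "emeasure (ctrl_measure u) A = (\<integral>\<^sup>+x. indicator A x \<partial>ctrl_measure u)" by simp
      also have "\<dots> = (SUP is\<in>?I. \<integral>\<^sup>+x. ennreal (tents is x) \<partial>ctrl_measure u)"
        by (rule nn_integral_lsc[OF D lsc sets_ctrl_measure])
      also have "\<dots> = (SUP is\<in>?I. ennreal (\<integral>x. tents is x \<partial>ctrl_measure u))"
        by (simp add: nn_integral_tents[OF ctrl_measure_in_borel_probs])
      finally show ?thesis .
    qed
    moreover have "countable ?I"
      by (rule countable_subset[of _ "lists (\<rat> \<times> UNIV \<times> D)"])
        (auto intro!: countable_lists countable_SIGMA D simp: countable_rat)
    then have "(\<lambda>u :: 'u ctrl. SUP is\<in>?I. ennreal (\<integral>x. tents is x \<partial>ctrl_measure u))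
        \<in> borel_measurable borel"
      by (intro borel_measurable_SUP measurable_compose[OF _ measurable_ennreal]
          borel_measurable_ctrl_integral_continuous continuous_on_tents bounded_tents)
    ultimately show "(\<lambda>u :: 'u ctrl. emeasure (ctrl_measure u) A) \<in> borel_measurable borel"
      by simp
  qed (auto simp: sets_ctrl_measure)
qed

section \<open>Second countability of the space of controls\<close>

text \<open>Adding a bound makes \<open>f\<close> nonnegative and hence a supremum of maxima of
  cones. If the integral exceeds a level, that of one such maximum does too, with a rational in
  between; monotonicity carries the bound over to all controls in the resulting generator
  set.\<close>

lemma generate_topology_ctrl_integral_greater:
  fixes f :: "real \<times> 'u :: polish_space \<Rightarrow> real"
  assumes D: "countable D" "\<And>X. open X \<Longrightarrow> X \<noteq> {} \<Longrightarrow> \<exists>d\<in>D. d \<in> X"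
    and f: "continuous_on ({0..} \<times> UNIV) f" "bounded (f ` ({0..} \<times> UNIV))"
  shows "generate_topology
    ((\<lambda>(is, q). {u. q < (\<integral>x. tents is x \<partial>ctrl_measure u)}) ` (lists (\<rat> \<times> UNIV \<times> D) \<times> \<rat>))
    {u. a < (\<integral>x. f x \<partial>ctrl_measure u)}"
    (is "generate_topology ?\<S> _")
proof (rule generate_topologyI)
  let ?S = "{0..} \<times> UNIV :: (real \<times> 'u) set"
  obtain B where B: "\<And>x. x \<in> ?S \<Longrightarrow> \<bar>f x\<bar> \<le> B"
    using f(2) by (auto simp: bounded_iff)
  define g where "g x = f x + B" for x
  have g_cont: "continuous_on ?S g" unfolding g_def by (intro continuous_intros f)
  have g_bdd: "bounded (g ` ?S)"
    unfolding g_def bounded_iff using B by (intro exI[of _ "2 * B"]) fastforce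
  have g_nonneg: "0 \<le> g x" if "x \<in> ?S" for x using B[OF that] by (simp add: g_def)
  have int_f: "integrable (ctrl_measure u) f" and int_g: "integrable (ctrl_measure u) g"
    for u :: "'u ctrl"
    using borel_probs_integrable[OF ctrl_measure_in_borel_probs] f g_cont g_bdd by blast+
  \<comment> \<open>Total mass one turns the added constant into a shift of the integral by exactly
    \<open>B\<close>.\<close>
  have shift: "(\<integral>x. g x \<partial>ctrl_measure u) = (\<integral>x. f x \<partial>ctrl_measure u) + B" for u :: "'u ctrl"
  proof -
    interpret prob_space "ctrl_measure u"
      using ctrl_measure_in_borel_probs[of u] by (simp add: borel_probs_def)
    show ?thesis unfolding g_def using int_f by (simp add: prob_space)
  qed
  fix u assume "u \<in> {u. a < (\<integral>x. f x \<partial>ctrl_measure u)}"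
  then have u: "a + B < (\<integral>x. g x \<partial>ctrl_measure u)" by (simp add: shift)
  show "\<exists>T. generate_topology ?\<S> T \<and> u \<in> T \<and> T \<subseteq> {u. a < (\<integral>x. f x \<partial>ctrl_measure u)}"
  \<comment> \<open>Passing to \<open>ennreal\<close> would truncate a negative level; in that case
    every control satisfies the bound.\<close>
  proof (cases "a + B < 0")
    case True
    have "a + B < (\<integral>x. g x \<partial>ctrl_measure v)" for v :: "'u ctrl"
      by (rule less_le_trans[OF True integral_nonneg_AE], rule AE_I2) (simp add: g_nonneg space_ctrl_measure)
    then show ?thesis by (auto simp: shift intro!: exI[of _ UNIV] generate_topology.UNIV)
  next
    case False
    have lsc: "openin (top_of_set ?S) {x\<in>?S. b < ennreal (g x)}" for b
    proof -
      have "openin (top_of_set ?S) (?S \<inter> (\<lambda>x. ennreal (g x)) -` {b<..})"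
        by (intro continuous_openin_preimage_gen continuous_on_ennreal g_cont) auto
      then show ?thesis by (simp add: vimage_def Int_def)
    qed
    have "ennreal (a + B) < ennreal (\<integral>x. g x \<partial>ctrl_measure u)"
      using u False by (intro ennreal_lessI) auto
    also have "\<dots> = (\<integral>\<^sup>+x. ennreal (g x) \<partial>ctrl_measure u)"
      using int_g by (intro nn_integral_eq_integral[symmetric]) (auto simp: g_nonneg space_ctrl_measure)
    also have "\<dots> = (SUP is\<in>{is\<in>lists (\<rat> \<times> UNIV \<times> D). \<forall>x\<in>?S. ennreal (tents is x) \<le> ennreal (g x)}.
        \<integral>\<^sup>+x. ennreal (tents is x) \<partial>ctrl_measure u)"
      by (rule nn_integral_lsc[OF D lsc sets_ctrl_measure])
    finally obtain "is" where "is": "is \<in> lists (\<rat> \<times> UNIV \<times> D)"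
      "\<And>x. x \<in> ?S \<Longrightarrow> ennreal (tents is x) \<le> ennreal (g x)"
      "ennreal (a + B) < (\<integral>\<^sup>+x. ennreal (tents is x) \<partial>ctrl_measure u)"
      unfolding less_SUP_iff by blast
    then have "a + B < (\<integral>x. tents is x \<partial>ctrl_measure u)"
      using False by (simp add: nn_integral_tents[OF ctrl_measure_in_borel_probs] ennreal_less_iff)
    then obtain q where q: "q \<in> \<rat>" "a + B < q" "q < (\<integral>x. tents is x \<partial>ctrl_measure u)"
      using Rats_dense_in_real by blast
    let ?T = "{v. q < (\<integral>x. tents is x \<partial>ctrl_measure v)}"
    have "generate_topology ?\<S> ?T"
      using "is"(1) q(1) by (intro generate_topology.Basis) force
    moreover have "a < (\<integral>x. f x \<partial>ctrl_measure v)" if "v \<in> ?T" for v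
    proof -
      have "(\<integral>x. tents is x \<partial>ctrl_measure v) \<le> (\<integral>x. g x \<partial>ctrl_measure v)"
        using "is"(2) g_nonneg int_g
          borel_probs_integrable[OF ctrl_measure_in_borel_probs continuous_on_tents bounded_tents]
        by (intro integral_mono) (auto simp: space_ctrl_measure)
      with that q(2) show ?thesis by (simp add: shift)
    qed
    ultimately show ?thesis using q(3) by blast
  qed
qed

text \<open>A pullback topology is generated by the preimages of a subbasis. In this form second
  countability and the description of the Borel field by generators become applicable.\<close>

lemma open_ctrl_eq_generate_topology:
  "open = generate_topology {{u :: 'u :: polish_space ctrl. (\<integral>x. f x \<partial>ctrl_measure u) \<in> V} | f V.
     continuous_on ({0..} \<times> UNIV) f \<and> bounded (f ` ({0..} \<times> UNIV)) \<and> open (V :: real set)}"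
  (is "_ = generate_topology ?\<S>")
proof (intro ext iffI)
  fix A :: "'u ctrl set"
  let ?S = "{0..} \<times> UNIV :: (real \<times> 'u) set"
  assume "open A"
  then obtain U where U: "generate_topology_on {{\<mu> \<in> borel_probs ?S. (\<integral>x. f x \<partial>\<mu>) \<in> V} | f V.
      continuous_on ?S f \<and> bounded (f ` ?S) \<and> open (V :: real set)} U" "A = ctrl_measure -` U"
    unfolding open_ctrl_def openin_pullback_topology weak_topology_def
      openin_topology_generated_by_iff by blast
  have "generate_topology ?\<S> (ctrl_measure -` U)"
    using U(1)
  proof (induction rule: generate_topology_on.induct)
    \<comment> \<open>The empty set arises in \<open>generate_topology\<close> as the empty
      union.\<close>
    case Empty
    then show ?case using generate_topology.UN[of "{}" ?\<S>] by simp
  next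
    case (Int a b)
    then show ?case by (simp add: generate_topology.Int)
  next
    case (UN K)
    then show ?case unfolding vimage_Union by (intro generate_topology_Union)
  next
    case (Basis T)
    then obtain f V where fV: "T = {\<mu> \<in> borel_probs ?S. (\<integral>x. f x \<partial>\<mu>) \<in> V}"
      "continuous_on ?S f" "bounded (f ` ?S)" "open (V :: real set)" by blast
    have "ctrl_measure -` T = {u. (\<integral>x. f x \<partial>ctrl_measure u) \<in> V}"
      by (auto simp: fV(1) ctrl_measure_in_borel_probs)
    with fV(2-4) show ?case by (intro generate_topology.Basis) blast
  qed
  with U(2) show "generate_topology ?\<S> A" by simp
next
  fix A :: "'u ctrl set"
  assume "generate_topology ?\<S> A"
  then show "open A"
    by (rule open_generate_topology) (auto intro: open_ctrl_integral)
qed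

text \<open>Lower bounds on integrals of maxima of cones, with rational levels, form a countable
  family. They generate the lower bounds for every bounded continuous function, and with its
  negative also the upper bounds.\<close>

instance ctrl :: (polish_space) second_countable_topology
proof
  obtain D :: "(real \<times> 'a) set" where
    D: "countable D" "\<And>X. open X \<Longrightarrow> X \<noteq> {} \<Longrightarrow> \<exists>d\<in>D. d \<in> X"
    using countable_dense_setE by blast
  define \<S> where "\<S> = (\<lambda>(is, q). {u :: 'a ctrl. q < (\<integral>x. tents is x \<partial>ctrl_measure u)}) `
    (lists (\<rat> \<times> UNIV \<times> D) \<times> \<rat>)"
  let ?S = "{0..} \<times> UNIV :: (real \<times> 'a) set"
  have "countable \<S>"
    unfolding \<S>_def using D(1)
    by (intro countable_image countable_SIGMA countable_lists) (auto simp: countable_rat)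
  moreover have "open A = generate_topology \<S> A" for A :: "'a ctrl set"
  proof
    assume "generate_topology \<S> A"
    moreover have "open T" if "T \<in> \<S>" for T
      using that open_ctrl_integral[OF continuous_on_tents bounded_tents open_greaterThan]
      by (auto simp: \<S>_def)
    ultimately show "open A" by (rule open_generate_topology)
  next
    have basic: "generate_topology \<S> {u. (\<integral>x. f x \<partial>ctrl_measure u) \<in> V}"
      if f: "continuous_on ?S f" "bounded (f ` ?S)" and V: "open V" for f and V :: "real set"
    proof (rule generate_topologyI)
      have int: "integrable (ctrl_measure u) f" for u :: "'a ctrl"
        using borel_probs_integrable[OF ctrl_measure_in_borel_probs f] .
      fix u :: "'a ctrl" assume "u \<in> {u. (\<integral>x. f x \<partial>ctrl_measure u) \<in> V}"
      then obtain e where e: "e > 0" "ball (\<integral>x. f x \<partial>ctrl_measure u) e \<subseteq> V"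
        using V by (auto simp: open_contains_ball)
      let ?m = "\<integral>x. f x \<partial>ctrl_measure u"
      \<comment> \<open>The lower bound for \<open>- f\<close> is an upper bound for
        \<open>f\<close>; together they confine the integral to the ball around
        \<open>?m\<close>.\<close>
      let ?T = "{v. ?m - e < (\<integral>x. f x \<partial>ctrl_measure v)} \<inter> {v. - ?m - e < (\<integral>x. - f x \<partial>ctrl_measure v)}"
      have "bounded ((\<lambda>x. - f x) ` ?S)"
        using f(2) by (simp add: bounded_iff)
      then have "generate_topology \<S> ?T"
        unfolding \<S>_def using f
        by (intro generate_topology.Int generate_topology_ctrl_integral_greater[OF D]
            continuous_on_minus)
      moreover have "u \<in> ?T" using e(1) by simp
      moreover have "(\<integral>x. f x \<partial>ctrl_measure v) \<in> V" if "v \<in> ?T" for v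
        using that e(2) by (auto simp: dist_real_def subset_iff)
      ultimately show "\<exists>T. generate_topology \<S> T \<and> u \<in> T \<and> T \<subseteq> {u. (\<integral>x. f x \<partial>ctrl_measure u) \<in> V}"
        by blast
    qed
    assume "open A"
    then have "generate_topology {{u. (\<integral>x. f x \<partial>ctrl_measure u) \<in> V} | f V.
        continuous_on ?S f \<and> bounded (f ` ?S) \<and> open (V :: real set)} A"
      by (simp only: open_ctrl_eq_generate_topology)
    then show "generate_topology \<S> A"
      by (rule generate_topology_trans) (use basic in blast)
  qed
  ultimately show "\<exists>\<S> :: 'a ctrl set set. countable \<S> \<and> open = generate_topology \<S>"
    by blast
qed

section \<open>Integrals along controls as kernel integrals\<close>

lemma measurable_conv_add [measurable (raw)]:
  assumes [measurable]: "f \<in> borel_measurable M" "g \<in> borel_measurable M"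
  shows "(\<lambda>x. conv_add (f x) (g x)) \<in> borel_measurable M"
  unfolding conv_add_def by measurable

text \<open>The integrand may vary with the parameter as well as the kernel; this lets times and
  paths enter as parameters later.\<close>

lemma measurable_ext_integral_kernel:
  assumes f [measurable]: "(\<lambda>(x, y). f x y) \<in> borel_measurable (M \<Otimes>\<^sub>M N)"
    and L: "L \<in> measurable M (subprob_algebra N)"
  shows "(\<lambda>x. ext_integral (L x) (f x)) \<in> borel_measurable M"
proof -
  have "(\<lambda>x. \<integral>\<^sup>+y. e2ennreal (max 0 (f x y)) \<partial>L x) \<in> borel_measurable M"
    by (rule nn_integral_measurable_subprob_algebra2[OF _ L]) measurable
  moreover have "(\<lambda>x. \<integral>\<^sup>+y. e2ennreal (max 0 (- f x y)) \<partial>L x) \<in> borel_measurable M"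
    by (rule nn_integral_measurable_subprob_algebra2[OF _ L]) measurable
  ultimately show ?thesis unfolding ext_integral_def by measurable
qed

lemma ext_integral_eq_integral:
  assumes "integrable M f"
  shows "ext_integral M (\<lambda>x. ereal (f x)) = ereal (\<integral>x. f x \<partial>M)"
proof -
  have fin: "(\<integral>\<^sup>+x. ennreal (f x) \<partial>M) < \<infinity>" "(\<integral>\<^sup>+x. ennreal (- f x) \<partial>M) < \<infinity>"
    using assms by (auto simp: real_integrable_def less_top)
  have "ext_integral M (\<lambda>x. ereal (f x)) = conv_add (enn2ereal (\<integral>\<^sup>+x. ennreal (f x) \<partial>M))
      (- enn2ereal (\<integral>\<^sup>+x. ennreal (- f x) \<partial>M))"
    by (simp add: ext_integral_def ennreal_def)
  also have "\<dots> = ereal (\<integral>x. f x \<partial>M)"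
    using fin unfolding real_lebesgue_integral_def[OF assms]
    by (cases "\<integral>\<^sup>+x. ennreal (f x) \<partial>M"; cases "\<integral>\<^sup>+x. ennreal (- f x) \<partial>M")
      (auto simp: conv_add_def)
  finally show ?thesis .
qed

lemma nn_integral_graph_measure:
  fixes u :: "real \<Rightarrow> 'u :: polish_space"
  assumes u: "u \<in> borel_measurable (restrict_space borel {0..})"
    and g: "g \<in> borel_measurable (restrict_space borel ({0..} \<times> UNIV))"
  shows "(\<integral>\<^sup>+z. g z \<partial>graph_measure u) = (\<integral>\<^sup>+t\<in>{0..}. ennreal (exp (- t)) * g (t, u t) \<partial>lborel)"
proof -
  have e: "(\<lambda>t. ennreal (exp (- t))) \<in> borel_measurable (restrict_space lborel {0..})"
    by (rule measurable_restrict_space1) simp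
  have gu: "(\<lambda>t. g (t, u t)) \<in> borel_measurable (restrict_space lborel {0..})"
    using measurable_compose[OF measurable_graph[OF u, of "\<lambda>t. ennreal (exp (- t))"] g] by simp
  have "(\<integral>\<^sup>+z. g z \<partial>graph_measure u) =
      (\<integral>\<^sup>+t. g (t, u t) \<partial>density (restrict_space lborel {0..}) (\<lambda>t. ennreal (exp (- t))))"
    unfolding graph_measure_def by (rule nn_integral_distr[OF measurable_graph[OF u]]) (use g in simp)
  also have "\<dots> = (\<integral>\<^sup>+t. ennreal (exp (- t)) * g (t, u t) \<partial>restrict_space lborel {0..})"
    by (rule nn_integral_density[OF e gu])
  also have "\<dots> = (\<integral>\<^sup>+t\<in>{0..}. ennreal (exp (- t)) * g (t, u t) \<partial>lborel)"
    by (rule nn_integral_restrict_space) simp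
  finally show ?thesis .
qed

text \<open>The slice over time 0 has mass zero because a single point is Lebesgue null. This
  reconciles integrands given on positive times with test functions on all of
  \<open>{0..}\<close>.\<close>

lemma AE_ctrl_measure_pos:
  "AE z in ctrl_measure (u :: 'u :: polish_space ctrl). 0 < fst z"
proof -
  have "AE z in graph_measure v. 0 < fst z"
    if v: "v \<in> borel_measurable (restrict_space borel {0..})" for v :: "real \<Rightarrow> 'u"
  proof -
    let ?A = "{0} \<times> UNIV :: (real \<times> 'u) set"
    have A: "?A \<in> sets (restrict_space borel ({0..} \<times> UNIV))"
      by (auto simp: sets_restrict_space intro!: image_eqI[of _ _ ?A] borel_closed closed_Times)
    have "emeasure (graph_measure v) ?A = (\<integral>\<^sup>+z. indicator ?A z \<partial>graph_measure v)"
      using A by (simp add: graph_measure_def)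
    also have "\<dots> = (\<integral>\<^sup>+t\<in>{0..}. ennreal (exp (- t)) * indicator ?A (t, v t) \<partial>lborel)"
      using A by (intro nn_integral_graph_measure[OF v]) simp
    also have "\<dots> = (\<integral>\<^sup>+t. 0 \<partial>(lborel :: real measure))"
      using AE_lborel_singleton[of "0 :: real"]
      by (intro nn_integral_cong_AE) (auto elim!: eventually_mono split: split_indicator)
    finally have "?A \<in> null_sets (graph_measure v)"
      using A by (simp add: null_sets_def graph_measure_def)
    then show ?thesis
      by (rule AE_I') (auto simp: graph_measure_def space_restrict_space)
  qed
  then show ?thesis by transfer (simp add: ctrl_rel_def)
qed

text \<open>Extension by zero from the open set of positive times preserves measurability, and the
  condition on \<open>fst z\<close> hides the extension.\<close>

lemma measurable_weighted_restriction:
  fixes h :: "real \<times> 'u :: polish_space \<Rightarrow> ereal"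
  assumes S: "S \<in> sets borel"
    and h: "h \<in> borel_measurable (restrict_space borel ({0<..} \<times> UNIV))"
  shows "(\<lambda>z. if fst z \<in> S \<inter> {0<..} then ereal (exp (fst z)) * h z else 0) \<in> borel_measurable borel"
proof -
  let ?h = "\<lambda>z. if z \<in> {0<..} \<times> UNIV then h z else 0"
  have "open ({0<..} \<times> UNIV :: (real \<times> 'u) set)" by (intro open_Times) auto
  then have [measurable]: "?h \<in> borel_measurable borel"
    using h by (subst measurable_restrict_space_iff[symmetric]) auto
  have [measurable]: "fst \<in> measurable (borel :: (real \<times> 'u) measure) borel"
    by (intro borel_measurable_continuous_onI continuous_on_fst continuous_on_id)
  note S [measurable]
  have "(\<lambda>z. if fst z \<in> S then ereal (exp (fst z)) * ?h z else 0) \<in> borel_measurable borel"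
    by measurable
  also have "(\<lambda>z. if fst z \<in> S then ereal (exp (fst z)) * ?h z else 0) =
      (\<lambda>z. if fst z \<in> S \<inter> {0<..} then ereal (exp (fst z)) * h z else 0)"
    by (auto simp: fun_eq_iff)
  finally show ?thesis .
qed

text \<open>The density \<open>e\<^sup>-\<^sup>t\<close> of \<^const>\<open>ctrl_measure\<close> is compensated by \<open>e\<^sup>t\<close>, so that an integral
  along a control becomes an integral against a probability kernel.\<close>

lemma ctrl_integral_eq_ext_integral:
  fixes u :: "'u :: polish_space ctrl"
  assumes S: "S \<in> sets borel"
    and f: "f \<in> borel_measurable (restrict_space borel ({0<..} \<times> UNIV))"
  shows "ctrl_integral S (\<lambda>r x. f (r, x)) u = ext_integral (ctrl_measure u)
    (\<lambda>z. if fst z \<in> S \<inter> {0<..} then ereal (exp (fst z)) * f z else 0)"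
proof -
  let ?R = "restrict_space borel ({0<..} \<times> UNIV) :: (real \<times> 'u) measure"
  \<comment> \<open>Stated for a general \<open>h\<close> so that it applies to \<open>f\<close> and
    to \<open>- f\<close>, that is, to both parts of the integral.\<close>
  have part: "(\<integral>\<^sup>+r. e2ennreal (max 0 (if r \<in> S \<inter> {0<..} then h (r, v r) else 0)) \<partial>lborel) =
      (\<integral>\<^sup>+z. e2ennreal (max 0 (if fst z \<in> S \<inter> {0<..} then ereal (exp (fst z)) * h z else 0))
        \<partial>graph_measure v)"
    if h: "h \<in> borel_measurable ?R" and v: "v \<in> borel_measurable (restrict_space borel {0..})"
    for h and v :: "real \<Rightarrow> 'u"
  proof -
    let ?g = "\<lambda>z. e2ennreal (max 0 (if fst z \<in> S \<inter> {0<..} then ereal (exp (fst z)) * h z else 0))"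
    have "?g \<in> borel_measurable borel"
      using measurable_weighted_restriction[OF S h] by measurable
    then have "(\<integral>\<^sup>+z. ?g z \<partial>graph_measure v) =
        (\<integral>\<^sup>+t\<in>{0..}. ennreal (exp (- t)) * ?g (t, v t) \<partial>lborel)"
      by (intro nn_integral_graph_measure[OF v] measurable_restrict_space1)
    also have "\<dots> = (\<integral>\<^sup>+r. e2ennreal (max 0 (if r \<in> S \<inter> {0<..} then h (r, v r) else 0)) \<partial>lborel)"
    proof (rule nn_integral_cong)
      fix t :: real
      \<comment> \<open>At infinite \<open>y\<close> the positive finite factors change nothing; at
        finite \<open>y\<close> they cancel.\<close>
      have "ennreal (exp (- t)) * e2ennreal (max 0 (ereal (exp t) * y)) = e2ennreal (max 0 y)" for y
      proof (cases y)
        case (real r)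
        have "max 0 (ereal (exp t) * y) = ereal (exp t * max 0 r)"
          using real by (auto simp: max_def zero_le_mult_iff)
        moreover have "ennreal (exp (- t)) * ennreal (exp t * max 0 r) = ennreal (max 0 r)"
        proof -
          have "exp (- t) * (exp t * max 0 r) = max 0 r" by (simp add: exp_minus)
          moreover have "ennreal (exp (- t)) * ennreal (exp t * max 0 r) =
              ennreal (exp (- t) * (exp t * max 0 r))"
            by (rule ennreal_mult[symmetric]) simp_all
          ultimately show ?thesis by (simp only:)
        qed
        moreover have "max 0 y = ereal (max 0 r)"
          using real by (auto simp: max_def)
        ultimately show ?thesis by (simp only: e2ennreal_ereal)
      qed (auto simp: ennreal_mult_top)
      then show "ennreal (exp (- t)) * ?g (t, v t) * indicator {0..} t =
          e2ennreal (max 0 (if t \<in> S \<inter> {0<..} then h (t, v t) else 0))"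
        by (simp split: split_indicator)
    qed
    finally show ?thesis by simp
  qed
  have neg: "- (if P then x else 0) = (if P then - x else (0 :: ereal))" for P x by simp
  have f': "(\<lambda>z. - f z) \<in> borel_measurable ?R" using f by measurable
  have "\<exists>v. u = abs_ctrl v \<and> ctrl_rel v v"
    by (induction u rule: ctrl.abs_induct) blast
  then obtain v where v: "u = abs_ctrl v" "ctrl_rel v v" by blast
  then have m: "v \<in> borel_measurable (restrict_space borel {0..})" by (simp add: ctrl_rel_def)
  show ?thesis
    unfolding v(1) ctrl_integral.abs_eq[OF v(2)] ctrl_measure.abs_eq[OF v(2)] ext_integral_def
      neg part[OF f m] part[OF f' m] ereal_mult_minus_right by (rule refl)
qed

text \<open>The weight \<open>exp (- fst z)\<close> in the integrand supplies the density of the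
  control measure. Thus every integral that defines the topology is itself one of the
  functionals.\<close>

lemma I_fun_eq_integral:
  fixes f :: "real \<times> 'u :: polish_space \<Rightarrow> real"
  assumes f: "continuous_on ({0..} \<times> UNIV) f" "bounded (f ` ({0..} \<times> UNIV))"
  shows "I_fun (\<lambda>z. exp (- fst z) * f z) u = ereal (\<integral>z. f z \<partial>ctrl_measure u)"
proof -
  have "continuous_on ({0<..} \<times> UNIV) f"
    by (rule continuous_on_subset[OF f(1)]) auto
  then have "continuous_on ({0<..} \<times> UNIV) (\<lambda>z. ereal (exp (- fst z) * f z))"
    by (intro continuous_intros)
  then have "(\<lambda>z. ereal (exp (- fst z) * f z))
      \<in> borel_measurable (restrict_space borel ({0<..} \<times> UNIV))"
    by (rule borel_measurable_continuous_on_restrict)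
  then have "I_fun (\<lambda>z. exp (- fst z) * f z) u = ext_integral (ctrl_measure u)
      (\<lambda>z. if fst z \<in> {0<..} \<inter> {0<..} then ereal (exp (fst z)) * ereal (exp (- fst z) * f z) else 0)"
    unfolding I_fun_def by (rule ctrl_integral_eq_ext_integral[rotated]) simp
  also have "\<dots> = ext_integral (ctrl_measure u) (\<lambda>z. ereal (f z))"
  proof (rule ext_integral_cong_AE)
    have "exp r * (exp (- r) * y) = y" for r y :: real by (simp add: exp_minus)
    with AE_ctrl_measure_pos[of u]
    show "AE z in ctrl_measure u. (if fst z \<in> {0<..} \<inter> {0<..}
        then ereal (exp (fst z)) * ereal (exp (- fst z) * f z) else 0) = ereal (f z)"
      by (auto elim!: eventually_mono)
  qed
  also have "\<dots> = ereal (\<integral>z. f z \<partial>ctrl_measure u)"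
    by (intro ext_integral_eq_integral borel_probs_integrable[OF ctrl_measure_in_borel_probs] f)
  finally show ?thesis .
qed

section \<open>The sigma-field generated by the integral functionals\<close>

lemma borel_measurable_I_fun:
  fixes \<phi> :: "real \<times> 'u :: polish_space \<Rightarrow> real"
  assumes \<phi>: "\<phi> \<in> borel_measurable (restrict_space borel ({0<..} \<times> UNIV))"
  shows "I_fun \<phi> \<in> borel_measurable borel"
proof -
  let ?g = "\<lambda>z. if fst z \<in> {0<..} \<inter> {0<..} then ereal (exp (fst z)) * ereal (\<phi> z) else 0"
  have \<phi>': "(\<lambda>z. ereal (\<phi> z)) \<in> borel_measurable (restrict_space borel ({0<..} \<times> UNIV))"
    using \<phi> by measurable
  have "I_fun \<phi> u = ext_integral (ctrl_measure u) ?g" for u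
    unfolding I_fun_def by (rule ctrl_integral_eq_ext_integral[OF _ \<phi>']) simp
  moreover have "?g \<in> borel_measurable (restrict_space borel ({0..} \<times> UNIV))"
    by (intro measurable_restrict_space1 measurable_weighted_restriction \<phi>') simp
  then have "(\<lambda>u :: 'u ctrl. ext_integral (ctrl_measure u) ?g) \<in> borel_measurable borel"
    by (intro measurable_ext_integral_kernel[OF _ measurable_ctrl_measure])
      (simp add: split_beta' measurable_compose[OF measurable_snd])
  ultimately show ?thesis by (simp add: fun_eq_iff cong: measurable_cong)
qed

lemma sets_borel_ctrl:
  "sets (borel :: ('u :: polish_space) ctrl measure) =
     sigma_sets UNIV {I_fun \<phi> -` A | (\<phi> :: real \<times> 'u \<Rightarrow> real) (A :: ereal set).
       \<phi> \<in> borel_measurable (restrict_space borel ({0<..} \<times> UNIV)) \<and> A \<in> sets borel}"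
    (is "_ = sigma_sets UNIV ?\<I>")
proof
  let ?S = "{0..} \<times> UNIV :: (real \<times> 'u) set"
  let ?\<B> = "{{u :: 'u ctrl. (\<integral>x. f x \<partial>ctrl_measure u) \<in> V} | f V.
     continuous_on ?S f \<and> bounded (f ` ?S) \<and> open (V :: real set)}"
  have "?\<B> \<subseteq> ?\<I>"
  proof
    fix B assume "B \<in> ?\<B>"
    then obtain f V where B: "B = {u :: 'u ctrl. (\<integral>x. f x \<partial>ctrl_measure u) \<in> V}"
      and f: "continuous_on ?S f" "bounded (f ` ?S)" and V: "open (V :: real set)" by blast
    have "continuous_on ({0<..} \<times> UNIV) f"
      by (rule continuous_on_subset[OF f(1)]) auto
    then have "continuous_on ({0<..} \<times> UNIV) (\<lambda>z. exp (- fst z) * f z)"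
      by (intro continuous_intros)
    then have "(\<lambda>z. exp (- fst z) * f z) \<in> borel_measurable (restrict_space borel ({0<..} \<times> UNIV))"
      by (rule borel_measurable_continuous_on_restrict)
    \<comment> \<open>The functional is finite here, so the condition on the real integral is a
      preimage of the copy of \<open>V\<close> in \<open>ereal\<close>, which is again open.\<close>
    moreover have "B = I_fun (\<lambda>z. exp (- fst z) * f z) -` (ereal ` V)"
      by (auto simp: B I_fun_eq_integral[OF f])
    moreover have "ereal ` V \<in> sets borel"
      using V by (intro borel_open) (rule open_ereal)
    ultimately show "B \<in> ?\<I>" by blast
  qed
  then show "sets (borel :: 'u ctrl measure) \<subseteq> sigma_sets UNIV ?\<I>"
    unfolding borel_eq_sigma_generate_topology[OF open_ctrl_eq_generate_topology]
    by (simp add: sigma_sets_mono')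
  have "?\<I> \<subseteq> sets borel"
    using measurable_sets[OF borel_measurable_I_fun] by fastforce
  then show "sigma_sets UNIV ?\<I> \<subseteq> sets (borel :: 'u ctrl measure)"
    using sets.sigma_sets_subset[of ?\<I> borel] by simp
qed

section \<open>Measurability of the path functional\<close>

lemma measurable_apply_cpath [measurable (raw)]:
  fixes g :: "'b \<Rightarrow> ('a :: {metric_space, second_countable_topology}) cpath"
  assumes "f \<in> borel_measurable M" "g \<in> borel_measurable M"
  shows "(\<lambda>x. apply_cpath (g x) (max 0 (f x))) \<in> borel_measurable M"
  \<comment> \<open>Second countability of the path space makes the pair of time and path Borel
    measurable into the product, so joint continuity suffices.\<close>
  using borel_measurable_continuous_on[OF continuous_on_eval_cpath borel_measurable_Pair[OF assms]]
  by simp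

lemma measurable_stopped [measurable (raw)]:
  fixes g :: "'b \<Rightarrow> ('a :: {metric_space, second_countable_topology}) cpath"
  assumes "f \<in> borel_measurable M" "g \<in> borel_measurable M"
  shows "(\<lambda>x. stopped (f x) (g x)) \<in> borel_measurable M"
  using borel_measurable_continuous_on[OF continuous_on_stopped borel_measurable_Pair[OF assms]]
  by simp

lemma ctrl_integral_cong:
  fixes u :: "'u :: polish_space ctrl"
  assumes "\<And>r x. r \<in> S \<Longrightarrow> 0 < r \<Longrightarrow> f r x = g r x"
  shows "ctrl_integral S f u = ctrl_integral S g u"
proof -
  have "(if r \<in> S \<inter> {0<..} then f r x else 0) = (if r \<in> S \<inter> {0<..} then g r x else 0)" for r x
    using assms by simp
  then show ?thesis by transfer simp
qed

text \<open>Used to pass from full Borel spaces to restricted ones, one factor at a time.\<close>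

lemma measurable_ident_pair_measure:
  assumes "(\<lambda>x. x) \<in> measurable M M'" "(\<lambda>x. x) \<in> measurable N N'"
  shows "(\<lambda>x. x) \<in> measurable (M \<Otimes>\<^sub>M N) (M' \<Otimes>\<^sub>M N')"
  using measurable_Pair[OF measurable_compose[OF measurable_fst assms(1)]
      measurable_compose[OF measurable_snd assms(2)]]
  by simp

lemma measurable_ident_restrict_space: "(\<lambda>x. x) \<in> measurable (restrict_space M A) M"
  by (intro measurable_restrict_space1 measurable_ident_sets refl)

text \<open>The moving interval becomes a condition inside the integrand. The integrand is then
  jointly measurable in the parameters and in time and control value, and only the kernel depends on
  the control.\<close>

lemma measurable_ctrl_integral_path:
  fixes \<psi> :: "real \<times> (real ^ 'l) cpath \<times> ((real ^ 'd) \<times> (real ^ 'l)) \<times> 'u :: polish_space \<Rightarrow> ereal"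
  assumes \<psi>: "\<psi> \<in> borel_measurable (restrict_space borel ({0<..} \<times> UNIV))"
  shows "(\<lambda>(t, s, \<omega>0, \<omega>X, u). ctrl_integral {t<..t + s}
      (\<lambda>r x. \<psi> (r, stopped r \<omega>X, (apply_cpath \<omega>0 r, apply_cpath \<omega>X r), x)) u)
    \<in> borel_measurable (borel \<Otimes>\<^sub>M borel \<Otimes>\<^sub>M borel \<Otimes>\<^sub>M borel \<Otimes>\<^sub>M borel)"
proof -
  let ?M = "borel \<Otimes>\<^sub>M borel \<Otimes>\<^sub>M borel \<Otimes>\<^sub>M borel \<Otimes>\<^sub>M borel ::
    (real \<times> real \<times> (real ^ 'd) cpath \<times> (real ^ 'l) cpath \<times> 'u ctrl) measure"
  let ?N = "restrict_space borel ({0..} \<times> UNIV) :: (real \<times> 'u) measure"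
  define \<psi>' where "\<psi>' z = (if z \<in> {0<..} \<times> UNIV then \<psi> z else 0)" for z
  have "open ({0<..} \<times> UNIV :: (real \<times> (real ^ 'l) cpath \<times> ((real ^ 'd) \<times> (real ^ 'l)) \<times> 'u) set)"
    by (intro open_Times) auto
  then have \<psi>' [measurable]: "\<psi>' \<in> borel_measurable borel"
    unfolding \<psi>'_def using \<psi> by (subst measurable_restrict_space_iff[symmetric]) auto
  \<comment> \<open>Capping times below at 0 makes evaluation total, so its measurability holds on
    the whole space.\<close>
  define F where "F \<omega>0 \<omega>X z = \<psi>' (fst z, stopped (fst z) \<omega>X,
      (apply_cpath \<omega>0 (max 0 (fst z)), apply_cpath \<omega>X (max 0 (fst z))), snd z)"
    for \<omega>0 \<omega>X and z :: "real \<times> 'u"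
  define h where "h p z = (if fst z \<in> {fst p<..fst p + fst (snd p)} \<inter> {0<..}
      then ereal (exp (fst z)) * F (fst (snd (snd p))) (fst (snd (snd (snd p)))) z else 0)"
    for p :: "real \<times> real \<times> (real ^ 'd) cpath \<times> (real ^ 'l) cpath \<times> 'u ctrl" and z
  have "(\<lambda>(p, z). h p z) \<in> borel_measurable (?M \<Otimes>\<^sub>M (borel \<Otimes>\<^sub>M borel))"
    unfolding h_def F_def split_beta' Int_iff greaterThanAtMost_iff greaterThan_iff by measurable
  \<comment> \<open>The kernel lives on \<open>?N\<close>, whereas joint measurability was shown for
    the product of full Borel fields; the inclusion map connects them.\<close>
  moreover have "(\<lambda>x. x) \<in> measurable ?N (borel \<Otimes>\<^sub>M borel)"
    unfolding borel_prod by (rule measurable_ident_restrict_space)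
  then have "(\<lambda>x. x) \<in> measurable (?M \<Otimes>\<^sub>M ?N) (?M \<Otimes>\<^sub>M (borel \<Otimes>\<^sub>M borel))"
    by (rule measurable_ident_pair_measure[OF measurable_ident_sets[OF refl]])
  ultimately have "(\<lambda>(p, z). h p z) \<in> borel_measurable (?M \<Otimes>\<^sub>M ?N)"
    by (rule measurable_compose[rotated])
  moreover have "(\<lambda>p. ctrl_measure (snd (snd (snd (snd p))))) \<in> measurable ?M (subprob_algebra ?N)"
    by measurable
  ultimately have "(\<lambda>p. ext_integral (ctrl_measure (snd (snd (snd (snd p))))) (h p)) \<in> borel_measurable ?M"
    by (rule measurable_ext_integral_kernel)
  moreover have "ctrl_integral {t<..t + s}
      (\<lambda>r x. \<psi> (r, stopped r \<omega>X, (apply_cpath \<omega>0 r, apply_cpath \<omega>X r), x)) u =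
      ext_integral (ctrl_measure u) (h (t, s, \<omega>0, \<omega>X, u))" for t s \<omega>0 \<omega>X u
  proof -
    have "F \<omega>0 \<omega>X \<in> borel_measurable (borel \<Otimes>\<^sub>M borel)"
      unfolding F_def by measurable
    then have "F \<omega>0 \<omega>X \<in> borel_measurable (restrict_space borel ({0<..} \<times> UNIV))"
      unfolding borel_prod by (rule measurable_restrict_space1)
    then have "ctrl_integral {t<..t + s} (\<lambda>r x. F \<omega>0 \<omega>X (r, x)) u =
        ext_integral (ctrl_measure u) (h (t, s, \<omega>0, \<omega>X, u))"
      unfolding h_def fst_conv snd_conv by (rule ctrl_integral_eq_ext_integral[rotated]) simp
    \<comment> \<open>At positive times both the extension by zero and the cap disappear.\<close>
    moreover have "ctrl_integral {t<..t + s} (\<lambda>r x. F \<omega>0 \<omega>X (r, x)) u = ctrl_integral {t<..t + s}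
        (\<lambda>r x. \<psi> (r, stopped r \<omega>X, (apply_cpath \<omega>0 r, apply_cpath \<omega>X r), x)) u"
      by (rule ctrl_integral_cong) (simp add: F_def \<psi>'_def)
    ultimately show ?thesis by simp
  qed
  ultimately show ?thesis by (simp add: split_beta')
qed

theorem lemma1p3:
  shows "sets (borel :: ('u :: polish_space) ctrl measure) =
           sigma_sets UNIV {I_fun \<phi> -` A | (\<phi> :: real \<times> 'u \<Rightarrow> real) (A :: ereal set).
             \<phi> \<in> borel_measurable (restrict_space borel ({0<..} \<times> UNIV)) \<and> A \<in> sets borel}
       \<and> (\<forall>\<psi> :: real \<times> (real ^ 'l) cpath \<times> ((real ^ 'd) \<times> (real ^ 'l)) \<times> 'u \<Rightarrow> ereal.
           \<psi> \<in> borel_measurable (restrict_space borel ({0<..} \<times> UNIV)) \<longrightarrow>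
           (\<lambda>(t, s, \<omega>0, \<omega>X, u). ctrl_integral {t<..t + s}
              (\<lambda>r x. \<psi> (r, stopped r \<omega>X, (apply_cpath \<omega>0 r, apply_cpath \<omega>X r), x)) u)
           \<in> borel_measurable
               (restrict_space borel {0..} \<Otimes>\<^sub>M restrict_space borel {0..} \<Otimes>\<^sub>M
                restrict_space borel \<Omega>\<^sub>0 \<Otimes>\<^sub>M borel \<Otimes>\<^sub>M borel))"
proof (intro conjI sets_borel_ctrl allI impI)
  fix \<psi> :: "real \<times> (real ^ 'l) cpath \<times> ((real ^ 'd) \<times> (real ^ 'l)) \<times> 'u \<Rightarrow> ereal"
  assume \<psi>: "\<psi> \<in> borel_measurable (restrict_space borel ({0<..} \<times> UNIV))"
  show "(\<lambda>(t, s, \<omega>0, \<omega>X, u). ctrl_integral {t<..t + s}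
      (\<lambda>r x. \<psi> (r, stopped r \<omega>X, (apply_cpath \<omega>0 r, apply_cpath \<omega>X r), x)) u)
    \<in> borel_measurable
        (restrict_space borel {0..} \<Otimes>\<^sub>M restrict_space borel {0..} \<Otimes>\<^sub>M
         restrict_space borel \<Omega>\<^sub>0 \<Otimes>\<^sub>M borel \<Otimes>\<^sub>M borel)"
    \<comment> \<open>Compose the functional on the full product with the inclusion of the
      restricted domains.\<close>
    by (rule measurable_compose[OF _ measurable_ctrl_integral_path[OF \<psi>]])
      (intro measurable_ident_pair_measure measurable_ident_sets refl measurable_ident_restrict_space)
qed

end
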